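(* Let $\mathcal{G}$ be a minor-closed class of graphs with bounded treedepth. Then $$\chi_{\Delta}(\mathcal{G}) = \chi_{\star}(\mathcal{G}) = \operatorname{tcn}(\mathcal{G}) - 1.$$
   Context: All graphs are finite and simple. A $k$-colouring of a graph $G$ is any function assigning one of $k$ colours to each vertex; it need not be proper. A monochromatic component is a connected component of the subgraph induced by all vertices of one colour. A colouring has defect $d$ if every monochromatic component has maximum degree at most $d$. A colouring has clustering $c$ if every monochromatic component has at most $c$ vertices. For a graph class $\mathcal{G}$: - The defective chromatic number $\chi_{\Delta}(\mathcal{G})$ is the minimum integer $k$ such that, for some integer $d$, every graph in $\mathcal{G}$ is $k$-colourable with defect $d$. - The clustered chromatic number $\chi_{\star}(\mathcal{G})$ is the minimum integer $k$ such that, for some integer $c$, every graph in $\mathcal{G}$ is $k$-colourable with clustering $c$. Rooted trees. The depth of a rooted tree is the maximum number of vertices on a root-to-leaf path. The closure of a rooted tree $T$ is obtained from $T$ by adding an edge between every vertex and each of its descendants. For $h,k\ge 1$, $C\langle h,k\rangle$ denotes the closure of the complete $k$-ary tree of depth $h$. The tree-closure-number is $\operatorname{tcn}(\mathcal{G}) := \min\{h : \exists k\ C\langle h,k\rangle \notin \mathcal{G}\}$. Treedepth. The connected treedepth of a graph $H$ is the minimum depth of a rooted tree $T$ such that $H$ is a subgraph of the closure of $T$. The treedepth of $H$ is the maximum connected treedepth over the connected components of $H$. A class has bounded treedepth if some constant bounds the treedepth of every graph in it. Minors. A class $\mathcal{G}$ is minor-closed if every minor of every graph in $\mathcal{G}$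 (up to isomorphism) is in $\mathcal{G}$. *)

theory Defs
  imports
    "Graph_Theory.Digraph_Component"
    "Graph_Theory.Digraph_Isomorphism"
    "HOL-Library.Disjoint_Sets"
    "HOL-Library.Extended_Nat"
begin

text \<open>
  Finite simple graphs are the \<^locale>\<open>pair_graph\<close>s of the library: finite, loop-free,
  symmetric arc relations. A graph class is a set of such graphs with vertices in \<^typ>\<open>nat\<close>;
  every finite graph has an isomorphic copy of this kind.
  On symmetric digraphs, strongly connected components and connected components coincide, and
  the out-degree is the degree. The library's \<^const>\<open>connected\<close> excludes the null graph.
\<close>

abbreviation components :: "('a, 'b) pre_digraph \<Rightarrow> ('a, 'b) pre_digraph set" where
  "components \<equiv> pre_digraph.sccs"


subsection \<open>Defective and clustered colouring\<close>

definition mono_components ::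
  "'a pair_pre_digraph \<Rightarrow> ('a \<Rightarrow> nat) \<Rightarrow> ('a, 'a \<times> 'a) pre_digraph set" where
  "mono_components G f = (\<Union>c. components (with_proj G \<restriction> {v \<in> pverts G. f v = c}))"

definition defective_colourable :: "nat \<Rightarrow> nat \<Rightarrow> 'a pair_pre_digraph \<Rightarrow> bool" where
  "defective_colourable k d G \<longleftrightarrow> (\<exists>f. (\<forall>v \<in> pverts G. f v < k) \<and>
     (\<forall>C \<in> mono_components G f. \<forall>v \<in> verts C. out_degree C v \<le> d))"

definition clustered_colourable :: "nat \<Rightarrow> nat \<Rightarrow> 'a pair_pre_digraph \<Rightarrow> bool" where
  "clustered_colourable k c G \<longleftrightarrow> (\<exists>f. (\<forall>v \<in> pverts G. f v < k) \<and>
     (\<forall>C \<in> mono_components G f. card (verts C) \<le> c))"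

text \<open>Minima are taken in \<^typ>\<open>enat\<close>, so the minimum of the empty set is \<open>\<infinity>\<close>.\<close>

definition defective_chromatic :: "nat pair_pre_digraph set \<Rightarrow> enat" where
  "defective_chromatic \<G> = Inf {enat k | k. \<exists>d. \<forall>G \<in> \<G>. defective_colourable k d G}"

definition clustered_chromatic :: "nat pair_pre_digraph set \<Rightarrow> enat" where
  "clustered_chromatic \<G> = Inf {enat k | k. \<exists>c. \<forall>G \<in> \<G>. clustered_colourable k c G}"


subsection \<open>Rooted trees, closures and treedepth\<close>

text \<open>
  Rooted trees are represented with all edges oriented away from the root. The library's
  \<^const>\<open>tree\<close> only forbids directed cycles: it admits acyclic orientations of graphs that
  are not trees, and it rejects every symmetric digraph with an arc.
\<close>

definition rooted_tree :: "'a pair_pre_digraph \<Rightarrow> 'a \<Rightarrow> bool" where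
  "rooted_tree T r \<longleftrightarrow> pair_fin_digraph T \<and> r \<in> pverts T \<and>
     (\<forall>v \<in> pverts T. \<exists>!p. pre_digraph.awalk (with_proj T) r p v)"

definition rooted_depth :: "'a pair_pre_digraph \<Rightarrow> 'a \<Rightarrow> nat" where
  "rooted_depth T r = Max {length (pawalk_verts r p) | p v.
     pre_digraph.awalk (with_proj T) r p v \<and> out_degree (with_proj T) v = 0}"

definition tree_closure :: "'a pair_pre_digraph \<Rightarrow> 'a pair_pre_digraph" where
  "tree_closure T = \<lparr> pverts = pverts T,
     parcs = {(u, v). u \<rightarrow>\<^sup>+\<^bsub>with_proj T\<^esub> v \<or> v \<rightarrow>\<^sup>+\<^bsub>with_proj T\<^esub> u} \<rparr>"

text \<open>
  In the complete \<open>k\<close>-ary tree a vertex is the list of child indices on the path from the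
  root \<open>[]\<close> to it.
\<close>

definition complete_tree :: "nat \<Rightarrow> nat \<Rightarrow> nat list pair_pre_digraph" where
  "complete_tree h k =
     (let V = {xs. set xs \<subseteq> {..<k} \<and> length xs < h} in
       \<lparr> pverts = V, parcs = {(xs, xs @ [i]) | xs i. xs \<in> V \<and> xs @ [i] \<in> V} \<rparr>)"

definition closed_complete_tree :: "nat \<Rightarrow> nat \<Rightarrow> nat list pair_pre_digraph" (\<open>C\<langle>_,_\<rangle>\<close>) where
  "C\<langle>h,k\<rangle> = tree_closure (complete_tree h k)"

definition has_copy :: "nat pair_pre_digraph set \<Rightarrow> 'a pair_pre_digraph \<Rightarrow> bool" where
  "has_copy \<G> H \<longleftrightarrow> (\<exists>G \<in> \<G>. digraph_iso (with_proj H) (with_proj G))"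

definition tcn :: "nat pair_pre_digraph set \<Rightarrow> enat" where
  "tcn \<G> = Inf {enat h | h. h \<ge> 1 \<and> (\<exists>k \<ge> 1. \<not> has_copy \<G> C\<langle>h,k\<rangle>)}"

definition connected_treedepth :: "('a, 'a \<times> 'a) pre_digraph \<Rightarrow> nat" where
  "connected_treedepth H = (LEAST d. \<exists>T r. rooted_tree T r \<and>
     subgraph H (with_proj (tree_closure T)) \<and> rooted_depth T r = d)"

text \<open>The null graph has no components; its treedepth is \<open>0\<close>.\<close>

definition treedepth :: "'a pair_pre_digraph \<Rightarrow> nat" where
  "treedepth G = Max (insert 0 (connected_treedepth ` components (with_proj G)))"

definition bounded_treedepth :: "nat pair_pre_digraph set \<Rightarrow> bool" where
  "bounded_treedepth \<G> \<longleftrightarrow> (\<exists>b. \<forall>G \<in> \<G>. treedepth G \<le> b)"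


subsection \<open>Minors\<close>

definition contract :: "'a pair_pre_digraph \<Rightarrow> 'a set set \<Rightarrow> 'a set pair_pre_digraph" where
  "contract G P = \<lparr> pverts = P,
     parcs = {(X, Y). X \<in> P \<and> Y \<in> P \<and> X \<noteq> Y \<and> (\<exists>x \<in> X. \<exists>y \<in> Y. (x, y) \<in> parcs G)} \<rparr>"

text \<open>
  Contracting some set of edges of \<open>G'\<close>, and suppressing loops and parallel edges, amounts to
  contracting each part of a partition of its vertices into connected sets.
\<close>

definition is_minor :: "'b pair_pre_digraph \<Rightarrow> 'a pair_pre_digraph \<Rightarrow> bool" where
  "is_minor H G \<longleftrightarrow> (\<exists>G' P. pair_graph G' \<and> subgraph (with_proj G') (with_proj G) \<and>
     partition_on (pverts G') P \<and> (\<forall>X \<in> P. connected (with_proj G' \<restriction> X)) \<and>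
     digraph_iso (with_proj (contract G' P)) (with_proj H))"

definition minor_closed :: "nat pair_pre_digraph set \<Rightarrow> bool" where
  "minor_closed \<G> \<longleftrightarrow> (\<forall>G \<in> \<G>. \<forall>H. is_minor H G \<longrightarrow> H \<in> \<G>)"

end

theory Submission
  imports Defs
begin

text \<open>
  Lower bound: in a colouring of \<open>C\<langle>h,d+1\<rangle>\<close> of defect \<open>d\<close>, the colour of the root is missing from
  some child's subtree, so by induction at least \<open>h\<close> colours occur.

  Upper bound: suppose \<open>C\<langle>h,k\<rangle>\<close> is not a minor of \<open>G\<close>, and take an elimination forest of bounded
  depth whose subtrees are connected. Call a non-root vertex light if its subtree contains a
  model of some \<open>C\<langle>m,k\<rangle>\<close> seeing a set of its ancestors which at most \<open>k\<close> of the sibling subtrees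
  contain. A vertex has boundedly many light children, so the classes obtained by joining each
  light vertex to its parent have bounded size. Colour each class with one colour, top-down,
  avoiding the colours of the classes above that have a neighbour in its subtree.
  If there were \<open>h-1\<close> such classes, pick one neighbour in each. Between two of these
  vertices, and below the last, there is a vertex that is not light. Its subtree can be
  duplicated, so going up the tree each of the chosen vertices becomes the root of a larger
  model, and \<open>C\<langle>h,k\<rangle>\<close> would be a minor after all.
\<close>

section \<open>Connected sets and models of closures\<close>

definition conn :: "'a rel \<Rightarrow> 'a set \<Rightarrow> bool" where
  "conn E X \<longleftrightarrow> X \<noteq> {} \<and> (\<forall>x \<in> X. \<forall>y \<in> X. (x, y) \<in> rtrancl_on X E)"

lemma conn_insert:
  assumes "sym E" "conn E X" "z \<in> X" "(r, z) \<in> E"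
  shows "conn E (insert r X)"
proof -
  have mono: "(x, y) \<in> rtrancl_on (insert r X) E" if "(x, y) \<in> rtrancl_on X E" for x y
    using that by (rule rtrancl_on_mono[rotated 2]) auto
  have X: "(x, y) \<in> rtrancl_on (insert r X) E" if "x \<in> X" "y \<in> X" for x y
    using assms(2) that by (auto simp: conn_def intro: mono)
  have "(z, r) \<in> E" using assms(1,4) by (auto dest: symD)
  then have "(x, r) \<in> rtrancl_on (insert r X) E" if "x \<in> X" for x
    using X[OF that assms(3)] by (auto intro: rtrancl_on_into_rtrancl_on)
  moreover have "(r, y) \<in> rtrancl_on (insert r X) E" if "y \<in> X" for y
    using X[OF assms(3) that] assms(4) by (auto intro: converse_rtrancl_on_into_rtrancl_on)
  ultimately show ?thesis using X by (auto simp: conn_def)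
qed

text \<open>The vertex set of \<open>C\<langle>m,k\<rangle>\<close>; it is empty for
  \<open>m = 0\<close>.\<close>

definition tuples :: "nat \<Rightarrow> nat \<Rightarrow> nat list set" where
  "tuples m k = {xs. set xs \<subseteq> {..<k} \<and> length xs < m}"

lemma finite_tuples: "finite (tuples m k)"
proof (rule finite_subset)
  show "tuples m k \<subseteq> {xs. set xs \<subseteq> {..<k} \<and> length xs \<le> m}" by (auto simp: tuples_def)
qed (rule finite_lists_length_le, simp)

text \<open>
  A model of \<open>C\<langle>m,k\<rangle>\<close> inside \<open>S\<close> all of whose branch sets also see every vertex of \<open>A\<close>:
  the vertices in \<open>A\<close> wait to become roots of larger models.
\<close>

definition closure_model ::
  "'a rel \<Rightarrow> nat \<Rightarrow> nat \<Rightarrow> 'a set \<Rightarrow> 'a set \<Rightarrow> (nat list \<Rightarrow> 'a set) \<Rightarrow> bool" where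
  "closure_model E k m A S B \<longleftrightarrow>
     (\<forall>xs \<in> tuples m k. B xs \<subseteq> S \<and> conn E (B xs) \<and> (\<forall>a \<in> A. \<exists>z \<in> B xs. (a, z) \<in> E)) \<and>
     (\<forall>xs \<in> tuples m k. \<forall>ys \<in> tuples m k. xs \<noteq> ys \<longrightarrow> B xs \<inter> B ys = {}) \<and>
     (\<forall>xs ys. xs @ ys \<in> tuples m k \<and> ys \<noteq> [] \<longrightarrow> (\<exists>x \<in> B xs. \<exists>y \<in> B (xs @ ys). (x, y) \<in> E))"

definition rich :: "'a rel \<Rightarrow> nat \<Rightarrow> nat \<Rightarrow> 'a set \<Rightarrow> 'a set \<Rightarrow> bool" where
  "rich E k m A S \<longleftrightarrow> (\<exists>B. closure_model E k m A S B)"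

lemma rich_mono: "rich E k m A S \<Longrightarrow> S \<subseteq> S' \<Longrightarrow> rich E k m A S'"
  unfolding rich_def closure_model_def by (elim exE, rename_tac B, rule_tac x = B in exI) blast

text \<open>\<open>C\<langle>1,k\<rangle>\<close> is a single vertex, so all of \<open>S\<close> can
  be its branch set. Every larger model is built from this one.\<close>

lemma rich_1:
  assumes "conn E S" "\<And>a. a \<in> A \<Longrightarrow> \<exists>z \<in> S. (a, z) \<in> E"
  shows "rich E k 1 A S"
  unfolding rich_def closure_model_def
  by (rule exI[of _ "\<lambda>_. S"]) (use assms in \<open>auto simp: tuples_def\<close>)

text \<open>
  The spare model, with index \<open>k\<close>, makes the new root set \<open>{r} \<union> B k []\<close> see all of \<open>A\<close>, which \<open>r\<close>
  alone need not do.
\<close>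

lemma rich_Suc:
  assumes E: "sym E" and r: "r \<in> S" and m: "m \<ge> 1"
    and sub: "\<And>i. i \<le> k \<Longrightarrow> F i \<subseteq> S - {r}"
    and disj: "\<And>i j. i \<le> k \<Longrightarrow> j \<le> k \<Longrightarrow> i \<noteq> j \<Longrightarrow> F i \<inter> F j = {}"
    and rich: "\<And>i. i \<le> k \<Longrightarrow> rich E k m (insert r A) (F i)"
  shows "rich E k (Suc m) A S"
proof -
  have "\<forall>i. \<exists>B. i \<le> k \<longrightarrow> closure_model E k m (insert r A) (F i) B"
    using rich by (auto simp: rich_def)
  then obtain B where "\<And>i. i \<le> k \<Longrightarrow> closure_model E k m (insert r A) (F i) (B i)"
    by metis
  then have B_sub: "\<And>i xs. i \<le> k \<Longrightarrow> xs \<in> tuples m k \<Longrightarrow> B i xs \<subseteq> F i"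
    and B_conn: "\<And>i xs. i \<le> k \<Longrightarrow> xs \<in> tuples m k \<Longrightarrow> conn E (B i xs)"
    and B_A: "\<And>i xs a. i \<le> k \<Longrightarrow> xs \<in> tuples m k \<Longrightarrow> a \<in> insert r A \<Longrightarrow> \<exists>z \<in> B i xs. (a, z) \<in> E"
    and B_disj: "\<And>i xs ys. i \<le> k \<Longrightarrow> xs \<in> tuples m k \<Longrightarrow> ys \<in> tuples m k \<Longrightarrow> xs \<noteq> ys \<Longrightarrow>
                   B i xs \<inter> B i ys = {}"
    and B_adj: "\<And>i xs ys. i \<le> k \<Longrightarrow> xs @ ys \<in> tuples m k \<Longrightarrow> ys \<noteq> [] \<Longrightarrow>
                   \<exists>x \<in> B i xs. \<exists>y \<in> B i (xs @ ys). (x, y) \<in> E"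
    unfolding closure_model_def by blast+
  have Nil: "[] \<in> tuples m k" using m by (auto simp: tuples_def)
  have ConsD: "i \<le> k" "i < k" "xs \<in> tuples m k" if "i # xs \<in> tuples (Suc m) k" for i xs
    using that by (auto simp: tuples_def)
  have disj': "B i xs \<inter> B j ys = {}"
    if "i \<le> k" "j \<le> k" "xs \<in> tuples m k" "ys \<in> tuples m k" "i \<noteq> j \<or> xs \<noteq> ys" for i j xs ys
    using that disj[of i j] B_sub[of i xs] B_sub[of j ys] B_disj[of i xs ys]
    by (cases "i = j") blast+
  have r_notin: "r \<notin> B i xs" if "i \<le> k" "xs \<in> tuples m k" for i xs
    using B_sub[OF that] sub[OF that(1)] by blast
  \<comment> \<open>Copies \<open>i < k\<close> become the subtrees of the new root. All their sets
    see \<open>r\<close>, which gives every adjacency with the root set; a neighbour of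
    \<open>r\<close> in \<open>B k []\<close> makes the root set connected.\<close>
  define B' where "B' xs = (case xs of [] \<Rightarrow> insert r (B k []) | i # ys \<Rightarrow> B i ys)" for xs
  obtain z where z: "z \<in> B k []" "(r, z) \<in> E"
    using B_A[OF order_refl Nil, of r] by auto
  have "closure_model E k (Suc m) A S B'"
    unfolding closure_model_def
  proof (intro conjI ballI allI impI)
    fix xs assume xs: "xs \<in> tuples (Suc m) k"
    show "B' xs \<subseteq> S"
    proof (cases xs)
      case Nil
      then show ?thesis using r B_sub[OF order_refl \<open>[] \<in> tuples m k\<close>] sub[of k] by (auto simp: B'_def)
    next
      case (Cons i ys)
      with xs show ?thesis using B_sub[of i ys] sub[of i] ConsD[of i ys]
        by (fastforce simp: B'_def)
    qed
    show "conn E (B' xs)"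
      using conn_insert[OF E B_conn[OF order_refl Nil] z] B_conn ConsD xs
      by (cases xs) (auto simp: B'_def)
    fix a assume "a \<in> A"
    then show "\<exists>z\<in>B' xs. (a, z) \<in> E"
      using B_A[OF order_refl Nil, of a] B_A ConsD xs by (cases xs) (auto simp: B'_def)
  next
    fix xs ys assume xs: "xs \<in> tuples (Suc m) k" and ys: "ys \<in> tuples (Suc m) k" and "xs \<noteq> ys"
    have *: "insert r (B k []) \<inter> B i zs = {}" if "i # zs \<in> tuples (Suc m) k" for i zs
      using r_notin[of i zs] disj'[of k i "[]" zs] ConsD[OF that] Nil by auto
    show "B' xs \<inter> B' ys = {}"
    proof (cases xs; cases ys)
      fix i us j vs assume [simp]: "xs = i # us" "ys = j # vs"
      show ?thesis using disj'[of i j us vs] ConsD[of i us] ConsD[of j vs] xs ys \<open>xs \<noteq> ys\<close>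
        by (auto simp: B'_def)
    qed (use * xs ys \<open>xs \<noteq> ys\<close> in \<open>auto simp: B'_def\<close>)
  next
    fix xs ys assume "xs @ ys \<in> tuples (Suc m) k \<and> ys \<noteq> []"
    then have xy: "xs @ ys \<in> tuples (Suc m) k" and "ys \<noteq> []" by auto
    show "\<exists>x\<in>B' xs. \<exists>y\<in>B' (xs @ ys). (x, y) \<in> E"
    proof (cases xs)
      case Nil
      obtain i zs where ys: "ys = i # zs" using \<open>ys \<noteq> []\<close> by (cases ys) auto
      then have "\<exists>z \<in> B i zs. (r, z) \<in> E" using B_A[of i zs r] ConsD[of i zs] xy Nil by auto
      then show ?thesis using Nil ys by (auto simp: B'_def)
    next
      case (Cons i us)
      then show ?thesis using B_adj[of i us ys] ConsD[of i "us @ ys"] xy \<open>ys \<noteq> []\<close>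
        by (auto simp: B'_def)
    qed
  qed
  then show ?thesis by (auto simp: rich_def)
qed

text \<open>In order of increasing \<open>\<mu>\<close>, fewer than \<open>c\<close> colours are
  forbidden at \<open>t\<close> when its turn comes, so one is free. The induction runs over the
  levels below \<open>n\<close>.\<close>

lemma greedy_colouring:
  fixes \<mu> :: "'b \<Rightarrow> nat" and nb :: "'b \<Rightarrow> 'b set"
  assumes "\<And>t. t \<in> H \<Longrightarrow> finite (nb t)" "\<And>t. t \<in> H \<Longrightarrow> card (nb t) < c"
    "\<And>s t. t \<in> H \<Longrightarrow> s \<in> nb t \<Longrightarrow> \<mu> s < \<mu> t" "\<And>t. t \<in> H \<Longrightarrow> \<mu> t < n"
  obtains col :: "'b \<Rightarrow> nat"
  where "\<And>t. t \<in> H \<Longrightarrow> col t < c" "\<And>s t. t \<in> H \<Longrightarrow> s \<in> nb t \<Longrightarrow> col s \<noteq> col t"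
proof -
  have "\<exists>col. \<forall>t \<in> H. \<mu> t < n \<longrightarrow> col t < c \<and> (\<forall>s \<in> nb t. col s \<noteq> col t)"
  proof (induction n)
    case (Suc n)
    then obtain col where col: "\<forall>t \<in> H. \<mu> t < n \<longrightarrow> col t < c \<and> (\<forall>s \<in> nb t. col s \<noteq> col t)"
      by blast
    have "\<exists>i. t \<in> H \<longrightarrow> i < c \<and> i \<notin> col ` nb t" for t
    proof (cases "t \<in> H")
      case True
      have "card (col ` nb t) < card {..<c}"
        using assms(1,2)[OF True] card_image_le[of "nb t" col] by auto
      then have "\<not> {..<c} \<subseteq> col ` nb t"
        using card_mono[of "col ` nb t" "{..<c}"] assms(1)[OF True] by auto
      then show ?thesis by auto
    qed auto
    then obtain new where new: "\<And>t. t \<in> H \<Longrightarrow> new t < c \<and> new t \<notin> col ` nb t" by metis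
    \<comment> \<open>All elements of level \<open>n\<close> are coloured at once: \<open>nb\<close>
      points to strictly lower levels, so they do not constrain each other.\<close>
    let ?col = "\<lambda>t. if \<mu> t < n then col t else new t"
    have "?col t < c \<and> (\<forall>s \<in> nb t. ?col s \<noteq> ?col t)" if "t \<in> H" "\<mu> t < Suc n" for t
    proof (cases "\<mu> t < n")
      case True
      then have "\<mu> s < n" if "s \<in> nb t" for s
        using assms(3)[OF \<open>t \<in> H\<close> that] by simp
      then show ?thesis using True that col by auto
    next
      case False
      then have "\<mu> s < n" if "s \<in> nb t" for s using \<open>\<mu> t < Suc n\<close> assms(3)[OF \<open>t \<in> H\<close> that] by simp
      then have "?col s \<noteq> ?col t" if "s \<in> nb t" for s
        using False new[OF \<open>t \<in> H\<close>] that by (metis imageI)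
      then show ?thesis using False new[OF \<open>t \<in> H\<close>] by simp
    qed
    then show ?case by (intro exI[of _ ?col] ballI impI)
  qed auto
  then show ?thesis using that assms(4) by metis
qed

subsection \<open>Elimination forests\<close>

text \<open>\<open>D x\<close> is the vertex set of the subtree rooted at \<open>x\<close>.\<close>

locale elimination_preforest =
  fixes V :: "'a set" and E :: "'a rel" and D :: "'a \<Rightarrow> 'a set"
  assumes finite_V: "finite V" and sym_E: "sym E"
    and D_dom: "y \<in> D x \<Longrightarrow> x \<in> V \<and> y \<in> V"
    and D_refl: "x \<in> V \<Longrightarrow> x \<in> D x"
    and D_trans: "y \<in> D x \<Longrightarrow> D y \<subseteq> D x"
    and D_laminar: "z \<in> D x \<Longrightarrow> z \<in> D y \<Longrightarrow> x \<in> D y \<or> y \<in> D x"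
    and D_antisym: "x \<in> D y \<Longrightarrow> y \<in> D x \<Longrightarrow> x = y"
    and D_edge: "(x, y) \<in> E \<Longrightarrow> x \<in> D y \<or> y \<in> D x"
begin

definition Anc :: "'a \<Rightarrow> 'a set" where
  "Anc x = {y. x \<in> D y \<and> y \<noteq> x}"

lemma Anc_subset: "Anc x \<subseteq> V"
  by (auto simp: Anc_def dest: D_dom)

lemma finite_Anc: "finite (Anc x)"
  using Anc_subset finite_V by (rule finite_subset)

lemma Anc_psubset: "x \<in> D y \<Longrightarrow> x \<noteq> y \<Longrightarrow> Anc y \<subset> Anc x"
  using D_trans D_antisym D_refl D_dom by (auto simp: Anc_def)

lemma card_Anc_less: "x \<in> D y \<Longrightarrow> x \<noteq> y \<Longrightarrow> card (Anc y) < card (Anc x)"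
  by (rule psubset_card_mono[OF finite_Anc Anc_psubset])

text \<open>Equal \<open>Anc\<close> characterises siblings (or two roots). If their subtrees met,
  they would be comparable, and the lower one would have strictly more ancestors.\<close>

lemma siblings_disjoint:
  assumes "Anc w = Anc w'" "w \<noteq> w'"
  shows "D w \<inter> D w' = {}"
proof (rule ccontr)
  assume "D w \<inter> D w' \<noteq> {}"
  then have "w \<in> D w' \<or> w' \<in> D w" using D_laminar by blast
  then show False using assms Anc_psubset[of w w'] Anc_psubset[of w' w] by auto
qed

lemma D_component_subset: "{y. (x, y) \<in> rtrancl_on (D x) E} \<subseteq> D x"
  by (auto dest: in_rtrancl_on_in_F)

lemma rtrancl_on_E_sym: "(x, y) \<in> rtrancl_on S E \<Longrightarrow> (y, x) \<in> rtrancl_on S E"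
  using rtrancl_on_sym[OF sym_E] by (rule symD)

end

text \<open>Connectedness lets a whole subtree serve as a branch set, which is where every model
  starts.\<close>

locale elimination_forest = elimination_preforest +
  assumes D_conn: "x \<in> V \<Longrightarrow> conn E (D x)"

text \<open>
  Replacing each subtree by the connected component of its root makes all subtrees connected.
\<close>

lemma (in elimination_preforest) elimination_forest_components:
  "elimination_forest V E (\<lambda>x. {y. (x, y) \<in> rtrancl_on (D x) E})"
proof
  note mono = rtrancl_on_mono[where r = E and s = E, OF subset_refl]
  show "finite V" "sym E" by (fact finite_V, fact sym_E)
  fix x y z
  show "x \<in> V \<and> y \<in> V" if "y \<in> {y. (x, y) \<in> rtrancl_on (D x) E}"
    using that by (auto dest!: in_rtrancl_on_in_F dest: D_dom)
  show "x \<in> {y. (x, y) \<in> rtrancl_on (D x) E}" if "x \<in> V"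
    using that D_refl by auto
  show "{z. (y, z) \<in> rtrancl_on (D y) E} \<subseteq> {z. (x, z) \<in> rtrancl_on (D x) E}"
    if "y \<in> {y. (x, y) \<in> rtrancl_on (D x) E}"
  proof -
    have "D y \<subseteq> D x" using that D_component_subset D_trans by blast
    from mono[OF this] show ?thesis using that by (auto intro: rtrancl_on_trans)
  qed
  \<comment> \<open>When \<open>x\<close> lies below \<open>y\<close>, the walk from
    \<open>x\<close> to \<open>z\<close> runs inside \<open>D y\<close>; reversed, it extends the
    walk from \<open>y\<close> to \<open>z\<close> so as to reach \<open>x\<close>.\<close>
  have lam: "x \<in> {z. (y, z) \<in> rtrancl_on (D y) E}"
    if "(x, z) \<in> rtrancl_on (D x) E" "(y, z) \<in> rtrancl_on (D y) E" "x \<in> D y" for x y z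
  proof -
    have "(x, z) \<in> rtrancl_on (D y) E" using mono[OF D_trans[OF that(3)] that(1)] .
    then show ?thesis using that(2) rtrancl_on_E_sym by (auto intro: rtrancl_on_trans)
  qed
  show "x \<in> {z. (y, z) \<in> rtrancl_on (D y) E} \<or> y \<in> {z. (x, z) \<in> rtrancl_on (D x) E}"
    if "z \<in> {z. (x, z) \<in> rtrancl_on (D x) E}" "z \<in> {z. (y, z) \<in> rtrancl_on (D y) E}"
  proof -
    have "x \<in> D y \<or> y \<in> D x" using that D_component_subset D_laminar by blast
    then show ?thesis using lam that by blast
  qed
  show "x = y" if "x \<in> {z. (y, z) \<in> rtrancl_on (D y) E}" "y \<in> {z. (x, z) \<in> rtrancl_on (D x) E}"
    using that D_component_subset D_antisym by blast
  have edge: "x \<in> {z. (y, z) \<in> rtrancl_on (D y) E}" if "(y, x) \<in> E" "x \<in> D y" for x y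
    using rtrancl_on_into_rtrancl_on[OF rtrancl_on_refl that] D_dom[OF that(2)] D_refl by blast
  show "x \<in> {z. (y, z) \<in> rtrancl_on (D y) E} \<or> y \<in> {z. (x, z) \<in> rtrancl_on (D x) E}"
    if "(x, y) \<in> E"
    using D_edge[OF that] edge that sym_E by (auto dest: symD)
  show "conn E {y. (x, y) \<in> rtrancl_on (D x) E}" if "x \<in> V"
  proof -
    let ?D = "{y. (x, y) \<in> rtrancl_on (D x) E}"
    \<comment> \<open>Every vertex of a walk from \<open>x\<close> inside \<open>D x\<close> belongs
      to the component, so the walk can be confined to it.\<close>
    have "(x, y) \<in> rtrancl_on ?D E" if "(x, y) \<in> rtrancl_on (D x) E" for y
      using that
    proof (induction rule: rtrancl_on_induct)
      case base
      then show ?case by auto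
    next
      case (step y z)
      then have "z \<in> ?D" using rtrancl_on_into_rtrancl_on by fastforce
      then show ?case using step by (blast intro: rtrancl_on_into_rtrancl_on)
    qed
    then have "(y, z) \<in> rtrancl_on ?D E" if "y \<in> ?D" "z \<in> ?D" for y z
      using that rtrancl_on_trans[OF rtrancl_on_E_sym] by blast
    moreover have "x \<in> ?D" using D_refl[OF that] by simp
    ultimately show ?thesis unfolding conn_def by blast
  qed
qed

text \<open>Subtrees only shrink, so no ancestor is gained and a depth bound survives.\<close>

lemma (in elimination_preforest) Anc_components_subset:
  "elimination_preforest.Anc (\<lambda>x. {y. (x, y) \<in> rtrancl_on (D x) E}) x \<subseteq> Anc x"
proof -
  interpret D': elimination_forest V E "\<lambda>x. {y. (x, y) \<in> rtrancl_on (D x) E}"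
    by (rule elimination_forest_components)
  show ?thesis using D_component_subset unfolding D'.Anc_def Anc_def by blast
qed

section \<open>Light vertices and the classes they form\<close>

context elimination_forest
begin

context
  fixes k h :: nat
begin

text \<open>
  A vertex that is not light can be duplicated: whatever model its subtree contains occurs in more
  than \<open>k\<close> sibling subtrees.
\<close>

definition light :: "'a \<Rightarrow> bool" where
  "light x \<longleftrightarrow> Anc x \<noteq> {} \<and> (\<exists>A \<subseteq> Anc x. \<exists>m \<in> {1..h}. rich E k m A (D x) \<and>
     card {w \<in> V. Anc w = Anc x \<and> rich E k m A (D w)} \<le> k)"

text \<open>The classes are the light parts of the vertices that are not light. Allowing
  \<open>t\<close> itself to be light makes the size bound a recursion over children.\<close>

definition light_part :: "'a \<Rightarrow> 'a set" where
  "light_part t = {x \<in> D t. \<forall>z. x \<in> D z \<and> z \<in> D t \<and> z \<noteq> t \<longrightarrow> light z}"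

text \<open>For \<open>x\<close> in \<open>V\<close>, the nearest vertex at or above
  \<open>x\<close> that is not light; it names the class of \<open>x\<close>.\<close>

definition apex :: "'a \<Rightarrow> 'a" where
  "apex x = (THE t. x \<in> light_part t \<and> \<not> light t)"

text \<open>Two candidates are comparable, and the lower one, lying between \<open>x\<close> and the
  other, would have to be light.\<close>

lemma light_part_unique:
  assumes "x \<in> light_part s" "\<not> light s" "x \<in> light_part t" "\<not> light t"
  shows "s = t"
proof -
  have "s \<in> D t \<or> t \<in> D s" using assms D_laminar unfolding light_part_def by blast
  then show ?thesis using assms unfolding light_part_def by blast
qed

text \<open>A root is never light, so some vertex at or above \<open>x\<close> is not light; the
  deepest such vertex works. Depth is measured by \<open>card (Anc t)\<close>.\<close>

lemma ex_light_part:
  assumes "x \<in> V"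
  shows "\<exists>t. x \<in> light_part t \<and> \<not> light t"
proof -
  obtain r where r: "x \<in> D r" "\<And>y. x \<in> D y \<Longrightarrow> card (Anc r) \<le> card (Anc y)"
    using ex_has_least_nat[of "\<lambda>r. x \<in> D r" x "\<lambda>r. card (Anc r)"] D_refl[OF assms] by blast
  have "Anc r = {}"
  proof (rule ccontr)
    assume "Anc r \<noteq> {}"
    then obtain y where "r \<in> D y" "r \<noteq> y" by (auto simp: Anc_def)
    then show False using r card_Anc_less[of r y] D_trans by fastforce
  qed
  then have "\<not> light r" by (simp add: light_def)
  have "card (Anc t) < Suc (card V)" for t
    using card_mono[OF finite_V Anc_subset] by (simp add: le_imp_less_Suc)
  then obtain t where t: "x \<in> D t" "\<not> light t"
      "\<And>y. x \<in> D y \<Longrightarrow> \<not> light y \<Longrightarrow> card (Anc y) \<le> card (Anc t)"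
    using r(1) \<open>\<not> light r\<close>
      ex_has_greatest_nat[of "\<lambda>t. x \<in> D t \<and> \<not> light t" r "\<lambda>t. card (Anc t)"] by blast
  have "light z" if "x \<in> D z" "z \<in> D t" "z \<noteq> t" for z
    using that t card_Anc_less[of z t] by fastforce
  then show ?thesis using t by (auto simp: light_part_def)
qed

lemma apex_props:
  assumes "x \<in> V"
  shows "x \<in> light_part (apex x)" "\<not> light (apex x)"
  using theI'[of "\<lambda>t. x \<in> light_part t \<and> \<not> light t"] ex_light_part[OF assms] light_part_unique
  unfolding apex_def by blast+

lemma apex_eqI: "x \<in> light_part t \<Longrightarrow> \<not> light t \<Longrightarrow> apex x = t"
  unfolding apex_def using light_part_unique by blast

lemma in_D_apex: "x \<in> V \<Longrightarrow> x \<in> D (apex x)"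
  using apex_props(1) by (auto simp: light_part_def)

lemma apex_in_V: "x \<in> V \<Longrightarrow> apex x \<in> V"
  using in_D_apex D_dom by blast

text \<open>If \<open>y\<close> were in \<open>D (apex x)\<close>, every vertex from
  \<open>y\<close> up to just below \<open>apex x\<close> would also lie above \<open>x\<close> and
  hence be light, so \<open>y\<close> would share the apex of \<open>x\<close>.\<close>

lemma Anc_apexI:
  assumes "x \<in> D y" "apex y \<noteq> apex x"
  shows "y \<in> Anc (apex x)"
proof -
  have "x \<in> V" using assms D_dom by blast
  note t = in_D_apex[OF this] apex_props[OF this]
  have "y \<notin> D (apex x)"
  proof
    assume y: "y \<in> D (apex x)"
    have "y \<in> light_part (apex x)"
      using t(2) y D_trans assms(1) unfolding light_part_def by blast
    then show False using assms(2) t(3) apex_eqI by blast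
  qed
  moreover have "apex x \<in> D y \<or> y \<in> D (apex x)" using t(1) assms(1) D_laminar by blast
  ultimately show ?thesis by (auto simp: Anc_def)
qed

text \<open>Each round trades the lowest vertex of \<open>A\<close> for one more level of the model,
  keeping \<open>m + card A = h\<close>. Distinct apexes ensure that the remaining vertices still
  lie above the next vertex that is not light.\<close>

lemma rich_chain:
  assumes "t \<in> V" "\<not> light t" "A \<subseteq> Anc t" "inj_on apex A" "rich E k m A (D t)" "m \<ge> 1"
    "m + card A = h"
  shows "\<exists>v \<in> V. rich E k h {} (D v)"
  using assms
proof (induction "card A" arbitrary: t A m)
  case 0
  then have "A = {}" using finite_Anc finite_subset by (metis card_0_eq)
  then show ?case using 0 by auto
next
  case (Suc n)
  obtain a where "a \<in> A" using Suc.hyps(2) by fastforce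
  have "card (Anc t) < Suc (card V)" for t
    using card_mono[OF finite_V Anc_subset] by (simp add: le_imp_less_Suc)
  \<comment> \<open>\<open>A\<close> consists of ancestors of \<open>t\<close>, hence is a chain;
    \<open>r\<close> is its lowest member.\<close>
  then obtain r where r: "r \<in> A" "\<And>a. a \<in> A \<Longrightarrow> card (Anc a) \<le> card (Anc r)"
    using \<open>a \<in> A\<close> ex_has_greatest_nat[of "\<lambda>a. a \<in> A" a "\<lambda>a. card (Anc a)"] by blast
  have tr: "t \<in> D r" "t \<noteq> r" using r(1) Suc.prems by (auto simp: Anc_def)
  then have "r \<in> V" using D_dom by blast
  define W where "W = {w \<in> V. Anc w = Anc t \<and> rich E k m A (D w)}"
  \<comment> \<open>\<open>t\<close> is not a root and its subtree has a suitable model, so it can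
    fail to be light only by having more than \<open>k\<close> such siblings, itself included. These
    supply the \<open>Suc k\<close> copies: \<open>k\<close> branches and a spare.\<close>
  have "Anc t \<noteq> {}" "m \<in> {1..h}" using Suc.prems r(1) by auto
  then have "\<not> card W \<le> k"
    using \<open>\<not> light t\<close> Suc.prems(3,5) unfolding light_def W_def by blast
  then have "Suc k \<le> card W" by simp
  then obtain W' where W': "W' \<subseteq> W" "card W' = Suc k" "finite W'"
    using obtain_subset_with_card_n by metis
  then obtain w where w: "bij_betw w {0..<Suc k} W'"
    using ex_bij_betw_nat_finite[of W'] by auto
  have wW: "w i \<in> W" if "i \<le> k" for i
    using that W'(1) bij_betwE[OF w] by (auto simp: less_Suc_eq_le)
  have wr: "w i \<in> D r" "r \<notin> D (w i)" if "i \<le> k" for i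
  proof -
    have "r \<in> Anc (w i)" using wW[OF that] r(1) Suc.prems by (auto simp: W_def)
    then show "w i \<in> D r" "r \<notin> D (w i)" by (auto simp: Anc_def dest: D_antisym)
  qed
  have "rich E k (Suc m) (A - {r}) (D r)"
  proof (rule rich_Suc[where F = "\<lambda>i. D (w i)" and r = r])
    show "D (w i) \<subseteq> D r - {r}" if "i \<le> k" for i using wr[OF that] D_trans by blast
    show "D (w i) \<inter> D (w j) = {}" if "i \<le> k" "j \<le> k" "i \<noteq> j" for i j
    proof (rule siblings_disjoint)
      show "Anc (w i) = Anc (w j)" using wW that by (auto simp: W_def)
      show "w i \<noteq> w j" using w that by (auto simp: bij_betw_def inj_on_def)
    qed
    show "rich E k m (insert r (A - {r})) (D (w i))" if "i \<le> k" for i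
      using wW[OF that] r(1) by (simp add: W_def insert_absorb)
  qed (use sym_E D_refl[OF \<open>r \<in> V\<close>] Suc.prems in auto)
  \<comment> \<open>The next round must start at a vertex that is not light; \<open>apex r\<close>
    is one, and its subtree contains that of \<open>r\<close>.\<close>
  then have rich: "rich E k (Suc m) (A - {r}) (D (apex r))"
    by (rule rich_mono) (rule D_trans[OF in_D_apex[OF \<open>r \<in> V\<close>]])
  \<comment> \<open>The other members of \<open>A\<close> lie above \<open>r\<close> in different
    classes, so they are above the whole class of \<open>r\<close>.\<close>
  have Anc: "A - {r} \<subseteq> Anc (apex r)"
  proof
    fix a assume a: "a \<in> A - {r}"
    then have "t \<in> D a" using Suc.prems by (auto simp: Anc_def)
    then have "a \<in> D r \<or> r \<in> D a" using tr(1) D_laminar by blast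
    moreover have "a \<notin> D r" using card_Anc_less[of a r] r(2)[of a] a by auto
    moreover have "apex a \<noteq> apex r" using \<open>inj_on apex A\<close> a r(1) by (auto simp: inj_on_def)
    ultimately show "a \<in> Anc (apex r)" using Anc_apexI by blast
  qed
  have card: "card (A - {r}) = n" using Suc.hyps(2) r(1) by simp
  show ?case
  proof (rule Suc.hyps(1)[of "A - {r}" "apex r" "Suc m"])
    show "inj_on apex (A - {r})" using \<open>inj_on apex A\<close> by (rule inj_on_subset) auto
    show "Suc m + card (A - {r}) = h" using card Suc.hyps(2) Suc.prems by simp
  qed (use card rich Anc apex_in_V[OF \<open>r \<in> V\<close>] apex_props[OF \<open>r \<in> V\<close>] in auto)
qed

definition light_children :: "'a \<Rightarrow> 'a set" where
  "light_children p = {w \<in> V. Anc w = insert p (Anc p) \<and> light w}"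

text \<open>Each light child is charged to a pair \<open>(A, m)\<close> witnessing its lightness. At
  most \<open>k\<close> children share a pair, and \<open>A\<close> ranges over subsets of
  \<open>insert p (Anc p)\<close>.\<close>

lemma card_light_children: "card (light_children p) \<le> 2 ^ Suc (card (Anc p)) * h * k"
proof -
  define P where "P = insert p (Anc p)"
  define W where "W = (\<lambda>(A, m). {w \<in> V. Anc w = P \<and> rich E k m A (D w)})"
  define I where "I = {i \<in> Pow P \<times> {1..h}. card (W i) \<le> k}"
  have "finite P" using finite_Anc by (simp add: P_def)
  then have "finite I" by (simp add: I_def)
  have "light_children p \<subseteq> (\<Union>i \<in> I. W i)"
    unfolding light_children_def light_def I_def W_def P_def by fastforce
  moreover have "finite (\<Union>i \<in> I. W i)" using \<open>finite I\<close> finite_V by (auto simp: W_def)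
  ultimately have "card (light_children p) \<le> card (\<Union>i \<in> I. W i)" by (rule card_mono[rotated])
  also have "\<dots> \<le> (\<Sum>i \<in> I. card (W i))" by (rule card_UN_le[OF \<open>finite I\<close>])
  also have "\<dots> \<le> card I * k" using sum_bounded_above[of I "\<lambda>i. card (W i)" k] by (auto simp: I_def)
  also have "card I \<le> card (Pow P \<times> {1..h})"
    using \<open>finite P\<close> by (intro card_mono) (auto simp: I_def)
  also have "\<dots> = 2 ^ card P * h" using \<open>finite P\<close> by (simp add: card_cartesian_product card_Pow)
  also have "card P = Suc (card (Anc p))" using finite_Anc by (simp add: P_def Anc_def)
  finally show ?thesis by simp
qed

text \<open>For \<open>x\<close> other than \<open>p\<close>, the child of \<open>p\<close> on the
  way to \<open>x\<close> is light and has \<open>x\<close> in its light part. This child is the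
  highest vertex strictly below \<open>p\<close> and at or above \<open>x\<close>.\<close>

lemma light_part_subset:
  "light_part p \<subseteq> insert p (\<Union>w \<in> light_children p. light_part w)"
proof
  fix x assume x: "x \<in> light_part p"
  show "x \<in> insert p (\<Union>w \<in> light_children p. light_part w)"
  proof (cases "x = p")
    case False
    define Z where "Z z \<longleftrightarrow> x \<in> D z \<and> z \<in> D p \<and> z \<noteq> p" for z
    have "x \<in> D p" using x by (simp add: light_part_def)
    then have "Z x" using False D_refl D_dom by (auto simp: Z_def)
    then obtain w where w: "Z w" "\<And>z. Z z \<Longrightarrow> card (Anc w) \<le> card (Anc z)"
      using ex_has_least_nat[of Z x "\<lambda>z. card (Anc z)"] by blast
    have "Anc w = insert p (Anc p)"
    proof
      show "insert p (Anc p) \<subseteq> Anc w"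
        using w(1) Anc_psubset[of w p] by (auto simp: Z_def Anc_def)
      show "Anc w \<subseteq> insert p (Anc p)"
      proof
        fix y assume "y \<in> Anc w"
        then have y: "w \<in> D y" "y \<noteq> w" by (auto simp: Anc_def)
        have "\<not> Z y" using w(2)[of y] card_Anc_less[of w y] y by auto
        moreover have "x \<in> D y" using w(1) y(1) D_trans by (auto simp: Z_def)
        moreover have "y \<in> D p \<or> p \<in> D y" using w(1) y(1) D_laminar by (auto simp: Z_def)
        ultimately show "y \<in> insert p (Anc p)" by (auto simp: Z_def Anc_def)
      qed
    qed
    moreover have "light w" using w(1) x by (auto simp: Z_def light_part_def)
    moreover have "w \<in> V" using w(1) D_dom by (auto simp: Z_def)
    ultimately have "w \<in> light_children p" by (simp add: light_children_def)
    moreover have "x \<in> light_part w"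
      using x w(1) D_trans D_antisym unfolding light_part_def Z_def by blast
    ultimately show ?thesis by blast
  qed simp
qed

text \<open>Recursion over the remaining depth, with \<open>N\<close> bounding the light children:
  \<open>1 + N * (N + 1) ^ n \<le> (N + 1) ^ Suc n\<close>. The strict inequality makes
  \<open>n = 0\<close> impossible.\<close>

lemma card_light_part:
  assumes "\<And>x. x \<in> V \<Longrightarrow> card (Anc x) \<le> b" "p \<in> V" "b < card (Anc p) + n"
  shows "card (light_part p) \<le> Suc (2 ^ Suc b * h * k) ^ n"
  using assms(2,3)
proof (induction n arbitrary: p)
  case 0
  then show ?case using assms(1)[of p] by simp
next
  case (Suc n)
  let ?N = "2 ^ Suc b * h * k"
  have fin: "finite (light_children p)" using finite_V by (simp add: light_children_def)
  have finw: "finite (light_part w)" for w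
    by (rule finite_subset[OF _ finite_V]) (auto simp: light_part_def dest: D_dom)
  have w: "card (light_part w) \<le> Suc ?N ^ n" if "w \<in> light_children p" for w
  proof (rule Suc.IH)
    have "card (Anc w) = Suc (card (Anc p))"
      using that finite_Anc by (simp add: light_children_def Anc_def)
    then show "b < card (Anc w) + n" using Suc.prems by simp
  qed (use that in \<open>simp add: light_children_def\<close>)
  have "card (light_part p) \<le> card (insert p (\<Union>w \<in> light_children p. light_part w))"
    using light_part_subset finw fin by (intro card_mono) auto
  also have "\<dots> \<le> Suc (card (\<Union>w \<in> light_children p. light_part w))"
    by (rule card_insert_le_m1) auto
  also have "card (\<Union>w \<in> light_children p. light_part w) \<le> (\<Sum>w \<in> light_children p. card (light_part w))"
    by (rule card_UN_le[OF fin])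
  also have "\<dots> \<le> card (light_children p) * Suc ?N ^ n"
    using sum_bounded_above[of "light_children p" "\<lambda>w. card (light_part w)"] w by simp
  also have "card (light_children p) \<le> ?N"
  proof -
    have "2 ^ Suc (card (Anc p)) \<le> (2::nat) ^ Suc b"
      using assms(1)[OF Suc.prems(1)] by (intro power_increasing) auto
    then show ?thesis using card_light_children[of p] by (meson le_trans mult_le_mono1)
  qed
  finally have "card (light_part p) \<le> Suc (?N * Suc ?N ^ n)" by simp
  also have "\<dots> \<le> Suc ?N ^ Suc n" by simp
  finally show ?case .
qed

text \<open>The label of a vertex is its apex. Monochromatic components then lie within single
  classes, whose size is bounded.\<close>

lemma clustered_labelling:
  assumes h: "h \<ge> 1" and b: "\<And>x. x \<in> V \<Longrightarrow> card (Anc x) \<le> b"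
    and no_model: "\<And>v. v \<in> V \<Longrightarrow> \<not> rich E k h {} (D v)"
  obtains f :: "'a \<Rightarrow> nat" and l :: "'a \<Rightarrow> 'a" where
    "\<And>x. x \<in> V \<Longrightarrow> f x < h - 1"
    "\<And>x y. (x, y) \<in> E \<Longrightarrow> f x = f y \<Longrightarrow> l x = l y"
    "\<And>t. card {x \<in> V. l x = t} \<le> Suc (2 ^ Suc b * h * k) ^ Suc b"
proof -
  define near where "near t = {y \<in> Anc t. \<exists>z \<in> D t. (y, z) \<in> E}" for t
  define nb where "nb t = apex ` near t" for t
  have near_fin: "finite (near t)" for t using finite_Anc by (simp add: near_def)
  define H where "H = {t \<in> V. \<not> light t}"
  have nb_card: "card (nb t) < h - 1" if t: "t \<in> H" for t
  proof (rule ccontr)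
    assume "\<not> card (nb t) < h - 1"
    then obtain T where T: "T \<subseteq> nb t" "card T = h - 1"
      using obtain_subset_with_card_n[of "h - 1" "nb t"] by auto
    \<comment> \<open>One vertex per forbidden class, so \<open>apex\<close> is injective on
      \<open>A\<close>. The subtree of \<open>t\<close> is a model of height \<open>1\<close> seeing
      these \<open>h - 1\<close> vertices, and the chain raises the height to \<open>h\<close>. For
      \<open>h = 1\<close> this shows that \<open>H\<close> is empty.\<close>
    then obtain A where A: "A \<subseteq> near t" "inj_on apex A" "T = apex ` A"
      unfolding nb_def by (auto simp: subset_image_inj)
    have "card A = h - 1" using A T by (simp add: card_image)
    moreover have "rich E k 1 A (D t)"
      using A(1) t by (intro rich_1 D_conn) (auto simp: near_def H_def)
    ultimately have "\<exists>v \<in> V. rich E k h {} (D v)"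
      using A h t by (intro rich_chain[of t A 1]) (auto simp: near_def H_def)
    then show False using no_model by blast
  qed
  \<comment> \<open>\<open>apex y\<close> is at or above \<open>y\<close>, which is strictly above
    \<open>t\<close>; thus the number of ancestors orders the classes top-down.\<close>
  have mu: "card (Anc s) < card (Anc t)" if st: "s \<in> nb t" for s t
  proof -
    obtain y where y: "s = apex y" "t \<in> D y" "t \<noteq> y"
      using st by (auto simp: nb_def near_def Anc_def)
    then have "y \<in> D s" using in_D_apex D_dom by blast
    then have "t \<in> D s" using y D_trans by blast
    moreover have "t \<noteq> s" using y \<open>y \<in> D s\<close> D_antisym by blast
    ultimately show ?thesis by (rule card_Anc_less)
  qed
  obtain col where col: "\<And>t. t \<in> H \<Longrightarrow> col t < h - 1"
      "\<And>s t. t \<in> H \<Longrightarrow> s \<in> nb t \<Longrightarrow> col s \<noteq> col t"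
  proof (rule greedy_colouring[of H nb "h - 1" "\<lambda>t. card (Anc t)" "Suc b"])
    show "finite (nb t)" for t using near_fin by (simp add: nb_def)
    show "card (Anc t) < Suc b" if "t \<in> H" for t using b that by (simp add: H_def le_imp_less_Suc)
  qed (use nb_card mu in auto)
  have apexH: "apex x \<in> H" if "x \<in> V" for x using apex_in_V apex_props that by (simp add: H_def)
  \<comment> \<open>With \<open>x\<close> below \<open>y\<close> in another class, \<open>y\<close>
    is a proper ancestor of \<open>apex x\<close> with neighbour \<open>x\<close> in that subtree,
    so the colour of its class was forbidden.\<close>
  have edge: "apex x = apex y" if "(x, y) \<in> E" "col (apex x) = col (apex y)" "x \<in> D y" for x y
  proof (rule ccontr)
    assume "apex x \<noteq> apex y"
    then have "y \<in> Anc (apex x)" using Anc_apexI that(3) by metis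
    moreover have "x \<in> V" using that(3) D_dom by blast
    moreover have "(y, x) \<in> E" using that(1) sym_E by (auto dest: symD)
    ultimately have "apex y \<in> nb (apex x)" using in_D_apex by (auto simp: nb_def near_def)
    then show False using col(2)[OF apexH[OF \<open>x \<in> V\<close>]] that(2) by metis
  qed
  show ?thesis
  proof (rule that[of "\<lambda>x. col (apex x)" apex])
    show "col (apex x) < h - 1" if "x \<in> V" for x using col(1) apexH that by blast
    show "apex x = apex y" if "(x, y) \<in> E" "col (apex x) = col (apex y)" for x y
    proof -
      have "(y, x) \<in> E" using that(1) sym_E by (auto dest: symD)
      then show ?thesis using edge[of x y] edge[of y x] D_edge[OF that(1)] that by metis
    qed
    show "card {x \<in> V. apex x = t} \<le> Suc (2 ^ Suc b * h * k) ^ Suc b" for t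
    proof (cases "{x \<in> V. apex x = t} = {}")
      case True
      show ?thesis unfolding True by simp
    next
      case False
      then have "t \<in> V" using apex_in_V by auto
      have "{x \<in> V. apex x = t} \<subseteq> light_part t" using apex_props(1) by auto
      moreover have "finite (light_part t)"
        by (rule finite_subset[OF _ finite_V]) (auto simp: light_part_def dest: D_dom)
      ultimately have "card {x \<in> V. apex x = t} \<le> card (light_part t)" by (rule card_mono[rotated])
      also have "\<dots> \<le> Suc (2 ^ Suc b * h * k) ^ Suc b"
        using card_light_part[OF b \<open>t \<in> V\<close>, of "Suc b"] by simp
      finally show ?thesis .
    qed
  qed
qed

end

end

subsection \<open>Colourings and minors of graphs\<close>

lemma (in pair_fin_digraph) finite_components: "finite (components G)"
  by (simp add: sccs_conv_sccs_verts finite_sccs_verts)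

text \<open>Walks inside a monochromatic component preserve \<open>l\<close>, so the component lies
  in one fibre of \<open>l\<close>.\<close>

lemma clustered_colourableI:
  assumes "finite (pverts G)" "\<And>v. v \<in> pverts G \<Longrightarrow> f v < k"
    and l: "\<And>x y. (x, y) \<in> parcs G \<Longrightarrow> f x = f y \<Longrightarrow> l x = l y"
    and c: "\<And>t. card {x \<in> pverts G. l x = t} \<le> c"
  shows "clustered_colourable k c G"
  unfolding clustered_colourable_def
proof (intro exI[of _ f] conjI ballI)
  fix C assume "C \<in> mono_components G f"
  then obtain i where C: "C \<in> components (with_proj G \<restriction> {v \<in> pverts G. f v = i})"
    by (auto simp: mono_components_def)
  have ind: "induced_subgraph C (with_proj G \<restriction> {v \<in> pverts G. f v = i})"
    and sc: "strongly_connected C"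
    using C by (auto simp: pre_digraph.sccs_def)
  have V: "verts C \<subseteq> {v \<in> pverts G. f v = i}" using subgraph_imp_subverts[OF induced_imp_subgraph[OF ind]] by simp
  interpret C: wf_digraph C using ind by (rule wf_digraphI_induced)
  have step: "l x = l y" if "x \<rightarrow>\<^bsub>C\<^esub> y" for x y
  proof (rule l)
    have "x \<rightarrow>\<^bsub>with_proj G \<restriction> {v \<in> pverts G. f v = i}\<^esub> y"
      using that arcs_ends_mono[OF induced_imp_subgraph[OF ind]] by blast
    then show "(x, y) \<in> parcs G" by (auto dest: dominates_induce_subgraphD)
    show "f x = f y" using C.adj_in_verts[OF that] V by auto
  qed
  obtain u where u: "u \<in> verts C" using sc by (auto simp: strongly_connected_def)
  have "l v = l u" if "v \<in> verts C" for v
  proof -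
    have "u \<rightarrow>\<^sup>*\<^bsub>C\<^esub> v" using sc u that by (auto simp: strongly_connected_def)
    then show ?thesis by (induction rule: C.reachable_induct) (use step in auto)
  qed
  then have "verts C \<subseteq> {x \<in> pverts G. l x = l u}" using V by auto
  then have "card (verts C) \<le> card {x \<in> pverts G. l x = l u}"
    using assms(1) by (intro card_mono) auto
  then show "card (verts C) \<le> c" using c le_trans by blast
qed (use assms in auto)

text \<open>Arcs leaving \<open>v\<close> inside a component are determined by their heads, so its
  size bounds its degrees.\<close>

lemma clustered_imp_defective:
  assumes "finite (pverts G)" "clustered_colourable k c G"
  shows "defective_colourable k c G"
proof -
  obtain f where f: "\<forall>v \<in> pverts G. f v < k" "\<forall>C \<in> mono_components G f. card (verts C) \<le> c"
    using assms(2) by (auto simp: clustered_colourable_def)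
  have "out_degree C v \<le> c" if C: "C \<in> mono_components G f" and v: "v \<in> verts C" for C v
  proof -
    obtain i where "C \<in> components (with_proj G \<restriction> {v \<in> pverts G. f v = i})"
      using C by (auto simp: mono_components_def)
    then have ind: "induced_subgraph C (with_proj G \<restriction> {v \<in> pverts G. f v = i})"
      by (auto simp: pre_digraph.sccs_def)
    then have sub: "verts C \<subseteq> pverts G" "wf_digraph C" "tail C = fst" "head C = snd"
      by (auto dest!: induced_imp_subgraph simp: subgraph_def compatible_def)
    interpret C: wf_digraph C by fact
    have "out_arcs C v \<subseteq> Pair v ` verts C"
      using C.head_in_verts sub by (auto simp: out_arcs_def image_iff)
    moreover have fin: "finite (verts C)" using sub(1) assms(1) by (rule finite_subset)
    ultimately have "card (out_arcs C v) \<le> card (Pair v ` verts C)" by (intro card_mono) auto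
    also have "\<dots> \<le> card (verts C)" by (rule card_image_le[OF fin])
    also have "\<dots> \<le> c" using f C by blast
    finally show ?thesis by (simp add: out_degree_def)
  qed
  then show ?thesis using f(1) by (auto simp: defective_colourable_def)
qed

text \<open>Neighbours of \<open>v\<close> with its colour all lie in its monochromatic component,
  so components can be replaced by neighbourhoods.\<close>

lemma defective_colourableD:
  assumes "pair_graph G" "defective_colourable k d G"
  obtains f where "\<And>v. v \<in> pverts G \<Longrightarrow> f v < k"
    "\<And>v. v \<in> pverts G \<Longrightarrow> card {u. (v, u) \<in> parcs G \<and> f u = f v} \<le> d"
proof -
  interpret pair_graph G by fact
  obtain f where f: "\<forall>v \<in> pverts G. f v < k"
      "\<forall>C \<in> mono_components G f. \<forall>v \<in> verts C. out_degree C v \<le> d"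
    using assms(2) by (auto simp: defective_colourable_def)
  have "card {u. (v, u) \<in> parcs G \<and> f u = f v} \<le> d" if v: "v \<in> pverts G" for v
  proof -
    define H where "H = with_proj G \<restriction> {u \<in> pverts G. f u = f v}"
    have "induced_subgraph H G" unfolding H_def by (rule induced_induce) auto
    then interpret H: sym_digraph H by (rule induced_graph_imp_graph)
    define C where "C = H \<restriction> {u. v \<rightarrow>\<^sup>*\<^bsub>H\<^esub> u}"
    have vH: "v \<in> verts H" using v by (simp add: H_def)
    have "C \<in> components H" unfolding C_def by (rule H.induce_reachable_is_in_sccs[OF vH])
    then have "C \<in> mono_components G f" by (auto simp: mono_components_def H_def)
    moreover have "v \<in> verts C" using vH by (simp add: C_def)
    ultimately have "out_degree C v \<le> d" using f(2) by blast
    have out: "Pair v ` {u. (v, u) \<in> parcs G \<and> f u = f v} \<subseteq> out_arcs C v"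
    proof
      fix e assume "e \<in> Pair v ` {u. (v, u) \<in> parcs G \<and> f u = f v}"
      then obtain u where u: "e = (v, u)" "(v, u) \<in> parcs G" "f u = f v" by auto
      then have e: "e \<in> arcs H" using v in_arcsD2[of v u] by (auto simp: H_def)
      moreover have "v \<rightarrow>\<^bsub>H\<^esub> u" using H.dominatesI[OF _ e, of v u] u by (auto simp: H_def arc_to_ends_def)
      then have "v \<rightarrow>\<^sup>*\<^bsub>H\<^esub> v" "v \<rightarrow>\<^sup>*\<^bsub>H\<^esub> u" using H.reachable_refl[OF vH] H.reachable_adjI by blast+
      ultimately show "e \<in> out_arcs C v" using u by (simp add: C_def H_def)
    qed
    have "out_arcs C v \<subseteq> parcs G" by (auto simp: C_def H_def)
    then have "finite (out_arcs C v)" using pair_finite_arcs by (rule finite_subset)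
    then have "card (Pair v ` {u. (v, u) \<in> parcs G \<and> f u = f v}) \<le> card (out_arcs C v)"
      using out by (rule card_mono)
    then show ?thesis using \<open>out_degree C v \<le> d\<close> by (simp add: card_image inj_on_def out_degree_def)
  qed
  then show ?thesis using that f(1) by blast
qed

text \<open>Tails and heads are projections, so the vertex map determines the arc map of an
  isomorphism.\<close>

lemma digraph_iso_with_proj:
  "digraph_iso (with_proj G) (with_proj H) \<longleftrightarrow> pair_wf_digraph G \<and>
     (\<exists>g. inj_on g (pverts G) \<and> pverts H = g ` pverts G \<and> parcs H = map_prod g g ` parcs G)"
  (is "?L \<longleftrightarrow> ?R")
proof
  assume ?L
  then obtain g where g: "pre_digraph.digraph_isomorphism (with_proj G) g"
    and H: "with_proj H = app_iso g (with_proj G)"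
    by (auto simp: digraph_iso_def)
  have th: "iso_tail g = fst" "iso_head g = snd"
    using arg_cong[OF H, of tail] arg_cong[OF H, of head] by simp_all
  then have "iso_arcs g e = map_prod (iso_verts g) (iso_verts g) e" if "e \<in> parcs G" for e
    using g that by (cases e) (auto simp: pre_digraph.digraph_isomorphism_def prod_eq_iff)
  moreover have "pverts H = iso_verts g ` pverts G" "parcs H = iso_arcs g ` parcs G"
    using arg_cong[OF H, of verts] arg_cong[OF H, of arcs] by simp_all
  moreover have "inj_on (iso_verts g) (pverts G)" "pair_wf_digraph G"
    using g by (auto simp: pre_digraph.digraph_isomorphism_def wf_digraph_wp_iff)
  ultimately show ?R by (intro conjI exI[of _ "iso_verts g"]) (auto intro: image_cong)
next
  assume ?R
  then obtain g where wf: "pair_wf_digraph G" and g: "inj_on g (pverts G)" "pverts H = g ` pverts G"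
      "parcs H = map_prod g g ` parcs G" by blast
  interpret pair_wf_digraph G by fact
  let ?iso = "\<lparr>iso_verts = g, iso_arcs = map_prod g g, iso_head = snd, iso_tail = fst\<rparr>"
  have "inj_on (map_prod g g) (parcs G)"
    by (rule inj_on_subset[OF map_prod_inj_on[OF g(1) g(1)]]) (auto dest: in_arcsD1 in_arcsD2)
  then have "pre_digraph.digraph_isomorphism (with_proj G) ?iso"
    using g(1) wf by (auto simp: pre_digraph.digraph_isomorphism_def wf_digraph_wp_iff)
  moreover have "with_proj H = app_iso ?iso (with_proj G)"
    using g by (auto simp: app_iso_def with_proj_def)
  ultimately show ?L unfolding digraph_iso_def by blast
qed

section \<open>Colours forced by closures of complete trees\<close>

lemma pverts_closed_complete_tree: "pverts C\<langle>h,k\<rangle> = tuples h k"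
  by (auto simp: closed_complete_tree_def tree_closure_def complete_tree_def tuples_def Let_def)

lemma complete_tree_reachable:
  "(xs, ys) \<in> (parcs (complete_tree h k))\<^sup>+ \<longleftrightarrow>
     ys \<in> tuples h k \<and> (\<exists>zs. zs \<noteq> [] \<and> ys = xs @ zs)" (is "?L \<longleftrightarrow> ?R")
proof
  have arcs: "parcs (complete_tree h k) =
      {(xs, xs @ [i]) | xs i. xs \<in> tuples h k \<and> xs @ [i] \<in> tuples h k}"
    by (simp add: complete_tree_def tuples_def Let_def)
  show ?R if ?L
    using that
  proof (induction rule: trancl_induct)
    case (base ys)
    then show ?case unfolding arcs by blast
  next
    case (step ys us)
    then obtain zs i where "ys = xs @ zs" "us = ys @ [i]" "us \<in> tuples h k" unfolding arcs by blast
    then show ?case by (intro conjI exI[of _ "zs @ [i]"]) auto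
  qed
  show ?L if ?R
  proof -
    have "(xs, xs @ zs) \<in> (parcs (complete_tree h k))\<^sup>+" if "xs @ zs \<in> tuples h k" "zs \<noteq> []" for zs
      using that
    proof (induction zs rule: rev_induct)
      case (snoc i zs)
      then have "xs @ zs \<in> tuples h k" by (auto simp: tuples_def)
      then have "(xs @ zs, xs @ zs @ [i]) \<in> parcs (complete_tree h k)"
        using snoc by (auto simp: arcs)
      then show ?case
        using snoc.IH \<open>xs @ zs \<in> tuples h k\<close> by (cases "zs = []") (auto intro: trancl_into_trancl)
    qed simp
    then show ?thesis using \<open>?R\<close> by blast
  qed
qed

lemma parcs_closed_complete_tree:
  "(xs, ys) \<in> parcs C\<langle>h,k\<rangle> \<longleftrightarrow> xs \<in> tuples h k \<and> ys \<in> tuples h k \<and>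
     (\<exists>zs. zs \<noteq> [] \<and> (ys = xs @ zs \<or> xs = ys @ zs))"
proof -
  have "xs \<in> tuples h k" if "xs @ zs \<in> tuples h k" for xs zs
    using that by (auto simp: tuples_def)
  then show ?thesis
    by (auto simp: closed_complete_tree_def tree_closure_def complete_tree_reachable)
qed

text \<open>Induction on the height of the subtree at \<open>xs\<close>: some child's subtree misses
  the colour of \<open>xs\<close>, so the root adds a colour to those found there.\<close>

lemma colours_on_subtree:
  assumes "\<And>v. v \<in> tuples h (Suc d) \<Longrightarrow> card {u. (v, u) \<in> parcs C\<langle>h,Suc d\<rangle> \<and> f u = f v} \<le> d"
    and "set xs \<subseteq> {..d}" "length xs + m \<le> h"
  shows "m \<le> card (f ` (@) xs ` tuples m (Suc d))"
  using assms(2,3)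
proof (induction m arbitrary: xs)
  case (Suc m)
  let ?sub = "\<lambda>i. (@) (xs @ [i]) ` tuples m (Suc d)"
  have fin: "finite (f ` (@) xs ` tuples (Suc m) (Suc d))" using finite_tuples by auto
  \<comment> \<open>Otherwise each of the \<open>Suc d\<close> child subtrees contains a vertex
    coloured like \<open>xs\<close>. In the closure all of these are neighbours of
    \<open>xs\<close>, too many for defect \<open>d\<close>.\<close>
  have "\<exists>i \<le> d. f xs \<notin> f ` ?sub i"
  proof (rule ccontr)
    assume "\<not> (\<exists>i \<le> d. f xs \<notin> f ` ?sub i)"
    then have "\<forall>i. \<exists>zs. i \<le> d \<longrightarrow> zs \<in> tuples m (Suc d) \<and> f (xs @ i # zs) = f xs"
      by (fastforce simp: image_iff)
    then obtain z where z: "\<And>i. i \<le> d \<Longrightarrow> z i \<in> tuples m (Suc d)"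
        "\<And>i. i \<le> d \<Longrightarrow> f (xs @ i # z i) = f xs"
      by metis
    let ?U = "{u. (xs, u) \<in> parcs C\<langle>h,Suc d\<rangle> \<and> f u = f xs}"
    have xs: "xs \<in> tuples h (Suc d)" using Suc.prems by (auto simp: tuples_def)
    have "?U \<subseteq> tuples h (Suc d)" by (auto simp: parcs_closed_complete_tree)
    then have "finite ?U" using finite_tuples finite_subset by blast
    moreover have "(\<lambda>i. xs @ i # z i) ` {..d} \<subseteq> ?U"
      using z Suc.prems xs by (fastforce simp: parcs_closed_complete_tree tuples_def)
    ultimately have "card ((\<lambda>i. xs @ i # z i) ` {..d}) \<le> card ?U" by (rule card_mono)
    also have "\<dots> \<le> d" using assms(1)[OF xs] .
    also have "card ((\<lambda>i. xs @ i # z i) ` {..d}) = Suc d" by (simp add: card_image inj_on_def)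
    finally show False by simp
  qed
  then obtain i where i: "i \<le> d" "f xs \<notin> f ` ?sub i" by blast
  have "m \<le> card (f ` ?sub i)" using Suc.prems i by (intro Suc.IH) auto
  then have "Suc m \<le> card (insert (f xs) (f ` ?sub i))"
    using i(2) finite_tuples by (simp add: card_insert_if)
  also have "insert (f xs) (f ` ?sub i) \<subseteq> f ` (@) xs ` tuples (Suc m) (Suc d)"
  proof -
    have "[] \<in> tuples (Suc m) (Suc d)" "\<And>zs. zs \<in> tuples m (Suc d) \<Longrightarrow> i # zs \<in> tuples (Suc m) (Suc d)"
      using i by (auto simp: tuples_def)
    then show ?thesis by (force simp: image_iff)
  qed
  then have "card (insert (f xs) (f ` ?sub i)) \<le> card (f ` (@) xs ` tuples (Suc m) (Suc d))"
    by (rule card_mono[OF fin])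
  finally show ?case .
qed simp

lemma defective_colours_closed_complete_tree:
  assumes "pair_graph G" "digraph_iso (with_proj C\<langle>h,Suc d\<rangle>) (with_proj G)" "defective_colourable c d G"
  shows "h \<le> c"
proof -
  interpret pair_graph G by fact
  obtain g where g: "inj_on g (tuples h (Suc d))" "pverts G = g ` tuples h (Suc d)"
      "parcs G = map_prod g g ` parcs C\<langle>h,Suc d\<rangle>"
    using assms(2) by (auto simp: digraph_iso_with_proj pverts_closed_complete_tree)
  obtain f where f: "\<And>v. v \<in> pverts G \<Longrightarrow> f v < c"
    "\<And>v. v \<in> pverts G \<Longrightarrow> card {u. (v, u) \<in> parcs G \<and> f u = f v} \<le> d"
    using defective_colourableD[OF assms(1,3)] by blast
  have deg: "card {u. (v, u) \<in> parcs C\<langle>h,Suc d\<rangle> \<and> (f \<circ> g) u = (f \<circ> g) v} \<le> d" (is "card ?U \<le> d")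
    if v: "v \<in> tuples h (Suc d)" for v
  proof -
    have U: "?U \<subseteq> tuples h (Suc d)" by (auto simp: parcs_closed_complete_tree)
    have "{u. (g v, u) \<in> parcs G \<and> f u = f (g v)} \<subseteq> pverts G" using in_arcsD2 by auto
    then have "finite {u. (g v, u) \<in> parcs G \<and> f u = f (g v)}"
      using pair_finite_verts by (rule finite_subset)
    moreover have "g ` ?U \<subseteq> {u. (g v, u) \<in> parcs G \<and> f u = f (g v)}"
      by (auto simp: g(3) map_prod_def)
    ultimately have "card (g ` ?U) \<le> card {u. (g v, u) \<in> parcs G \<and> f u = f (g v)}"
      by (rule card_mono)
    moreover have "card (g ` ?U) = card ?U"
      using g(1) U by (intro card_image) (rule inj_on_subset)
    ultimately show ?thesis using f(2)[of "g v"] g(2) v by simp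
  qed
  have "h \<le> card ((f \<circ> g) ` (@) [] ` tuples h (Suc d))"
    using deg by (rule colours_on_subtree) auto
  also have "\<dots> \<le> card {..<c}"
    using f(1) g(2) by (intro card_mono) auto
  finally show ?thesis by simp
qed

section \<open>From models to minors\<close>

lemma connected_induced_iff:
  assumes "sym (parcs G)"
  shows "connected (with_proj G \<restriction> X) \<longleftrightarrow> conn (parcs G) X"
proof -
  have *: "rtrancl_on X (symcl (arcs_ends (with_proj G \<restriction> X))) = rtrancl_on X (parcs G)"
  proof (intro equalityI subrelI)
    fix x y
    show "(x, y) \<in> rtrancl_on X (parcs G)"
      if "(x, y) \<in> rtrancl_on X (symcl (arcs_ends (with_proj G \<restriction> X)))"
      using that by induction
        (use assms in \<open>auto simp: symcl_def arcs_ends_conv dest: symD intro: converse_rtrancl_on_into_rtrancl_on\<close>)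
    show "(x, y) \<in> rtrancl_on X (symcl (arcs_ends (with_proj G \<restriction> X)))"
      if "(x, y) \<in> rtrancl_on X (parcs G)"
      using that by induction
        (force simp: symcl_def arcs_ends_conv intro: converse_rtrancl_on_into_rtrancl_on)+
  qed
  show ?thesis by (simp add: connected_conv conn_def *)
qed

text \<open>The branch sets are the parts to contract, once all other vertices and the surplus edges
  are discarded.\<close>

lemma has_copy_if_rich:
  assumes "pair_graph G" "G \<in> \<G>" "minor_closed \<G>" "rich (parcs G) k h {} S" "S \<subseteq> pverts G"
  shows "has_copy \<G> C\<langle>h,k\<rangle>"
proof -
  interpret pair_graph G by fact
  define T where "T = tuples h k"
  obtain B where "closure_model (parcs G) k h {} S B" using assms(4) by (auto simp: rich_def)
  then have B_sub: "\<And>xs. xs \<in> T \<Longrightarrow> B xs \<subseteq> pverts G"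
    and B_conn: "\<And>xs. xs \<in> T \<Longrightarrow> conn (parcs G) (B xs)"
    and B_disj: "\<And>xs ys. xs \<in> T \<Longrightarrow> ys \<in> T \<Longrightarrow> xs \<noteq> ys \<Longrightarrow> B xs \<inter> B ys = {}"
    and B_adj: "\<And>xs ys. xs @ ys \<in> T \<Longrightarrow> ys \<noteq> [] \<Longrightarrow> \<exists>x \<in> B xs. \<exists>y \<in> B (xs @ ys). (x, y) \<in> parcs G"
    using assms(5) unfolding closure_model_def T_def by blast+
  have B_ne: "B xs \<noteq> {}" if "xs \<in> T" for xs using B_conn[OF that] by (simp add: conn_def)
  have B_inj: "inj_on B T" using B_disj B_ne by (metis inf.idem inj_onI)
  have B_eq: "xs = ys" if "x \<in> B xs" "x \<in> B ys" "xs \<in> T" "ys \<in> T" for x xs ys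
    using B_disj that by blast
  define K where "K = parcs C\<langle>h,k\<rangle>"
  have K: "(xs, ys) \<in> K \<longleftrightarrow> xs \<in> T \<and> ys \<in> T \<and> (\<exists>zs. zs \<noteq> [] \<and> (ys = xs @ zs \<or> xs = ys @ zs))" for xs ys
    by (simp add: K_def T_def parcs_closed_complete_tree)
  \<comment> \<open>Contraction keeps every adjacency, so edges between branch sets not adjacent in
    \<open>C\<langle>h,k\<rangle>\<close> are deleted first. Edges inside a branch set stay to keep
    it connected.\<close>
  define G' where "G' = \<lparr>pverts = \<Union>(B ` T), parcs = {(u, v) \<in> parcs G.
      \<exists>xs \<in> T. \<exists>ys \<in> T. u \<in> B xs \<and> v \<in> B ys \<and> (xs = ys \<or> (xs, ys) \<in> K)}\<rparr>"
  have parcs': "(u, v) \<in> parcs G' \<longleftrightarrow> (u, v) \<in> parcs G \<and>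
      (\<exists>xs \<in> T. \<exists>ys \<in> T. u \<in> B xs \<and> v \<in> B ys \<and> (xs = ys \<or> (xs, ys) \<in> K))" for u v
    by (simp add: G'_def)
  have pverts': "pverts G' = \<Union>(B ` T)" by (simp add: G'_def)
  have sym': "sym (parcs G')"
    using arcs_symmetric by (intro symI) (unfold parcs' K, blast)
  have sub': "pverts G' \<subseteq> pverts G" "parcs G' \<subseteq> parcs G"
    using B_sub by (auto simp: G'_def)
  have "finite (pverts G')" using sub'(1) pair_finite_verts by (rule finite_subset)
  moreover have "finite (parcs G')" using sub'(2) pair_finite_arcs by (rule finite_subset)
  ultimately have pg': "pair_graph G'"
    using no_loops' sym'
    by unfold_locales (auto simp: parcs' pverts' symmetric_def)
  then interpret G': pair_graph G' .
  have "subgraph (with_proj G') (with_proj G)"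
    using sub' by (intro subgraphI) (auto simp: G'.wf_digraph wf_digraph)
  moreover have "partition_on (pverts G') (B ` T)"
    using B_ne B_disj by (intro partition_onI) (auto simp: pverts' disjnt_def)
  moreover have "connected (with_proj G' \<restriction> X)" if X: "X \<in> B ` T" for X
  proof -
    obtain xs where xs: "xs \<in> T" "X = B xs" using X by blast
    have "(x, y) \<in> rtrancl_on X (parcs G')" if "(x, y) \<in> rtrancl_on X (parcs G)" for x y
      using that
    proof induction
      case (step x z)
      then have "(x, z) \<in> parcs G'" using xs unfolding parcs' by blast
      then show ?case using step by (auto intro: converse_rtrancl_on_into_rtrancl_on)
    qed simp
    then have "conn (parcs G') X" using B_conn[OF xs(1)] xs(2) by (auto simp: conn_def)
    then show ?thesis by (simp add: connected_induced_iff[OF sym'])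
  qed
  \<comment> \<open>Members of \<open>\<G>\<close> have natural numbers as vertices, so addresses
    are encoded by \<open>to_nat\<close>.\<close>
  moreover define H :: "nat pair_pre_digraph" where
    "H = \<lparr>pverts = to_nat ` T, parcs = map_prod to_nat to_nat ` K\<rparr>"
  have "digraph_iso (with_proj (contract G' (B ` T))) (with_proj H)"
  proof -
    have arcs: "parcs (contract G' (B ` T)) = map_prod B B ` K"
    proof (intro equalityI subsetI)
      fix e assume "e \<in> parcs (contract G' (B ` T))"
      then obtain xs ys x y where e: "e = (B xs, B ys)" "xs \<in> T" "ys \<in> T" "B xs \<noteq> B ys"
          "x \<in> B xs" "y \<in> B ys" "(x, y) \<in> parcs G'"
        unfolding contract_def by simp blast
      then have "(xs, ys) \<in> K" using B_eq unfolding parcs' by metis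
      then show "e \<in> map_prod B B ` K" using e(1) by force
    next
      fix e assume "e \<in> map_prod B B ` K"
      then obtain xs ys where e: "e = (B xs, B ys)" and xy: "(xs, ys) \<in> K" by auto
      then obtain zs where T: "xs \<in> T" "ys \<in> T" and zs: "zs \<noteq> []" "ys = xs @ zs \<or> xs = ys @ zs"
        by (auto simp: K)
      have "\<exists>x \<in> B xs. \<exists>y \<in> B ys. (x, y) \<in> parcs G"
        using zs(2) B_adj[of xs zs] B_adj[of ys zs] zs(1) T arcs_symmetric by blast
      then have "\<exists>x \<in> B xs. \<exists>y \<in> B ys. (x, y) \<in> parcs G'" using T xy unfolding parcs' by blast
      moreover have "B xs \<noteq> B ys" using B_inj T zs by (auto simp: inj_on_def)
      ultimately show "e \<in> parcs (contract G' (B ` T))" using T by (auto simp: e contract_def)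
    qed
    have verts: "pverts (contract G' (B ` T)) = B ` T" by (simp add: contract_def)
    let ?g = "\<lambda>X. to_nat (the_inv_into T B X)"
    have g: "the_inv_into T B (B xs) = xs" if "xs \<in> T" for xs
      using that by (simp add: the_inv_into_f_f[OF B_inj])
    show ?thesis
      unfolding digraph_iso_with_proj
    proof (intro conjI exI[of _ ?g])
      show "pair_wf_digraph (contract G' (B ` T))"
        by unfold_locales (auto simp: contract_def)
      show "inj_on ?g (pverts (contract G' (B ` T)))" unfolding verts by (auto simp: inj_on_def g)
      show "pverts H = ?g ` pverts (contract G' (B ` T))"
        unfolding verts by (auto simp: H_def g image_image)
      show "parcs H = map_prod ?g ?g ` parcs (contract G' (B ` T))"
        unfolding arcs H_def image_image
        by (auto simp: K g intro!: image_cong)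
    qed
  qed
  ultimately have "is_minor H G" unfolding is_minor_def using pg' by blast
  then have "H \<in> \<G>" using assms(2,3) unfolding minor_closed_def by blast
  moreover have "digraph_iso (with_proj C\<langle>h,k\<rangle>) (with_proj H)"
    unfolding digraph_iso_with_proj
  proof (intro conjI exI[of _ to_nat])
    show "pair_wf_digraph C\<langle>h,k\<rangle>"
      by unfold_locales (auto simp: parcs_closed_complete_tree pverts_closed_complete_tree)
  qed (auto simp: H_def T_def K_def pverts_closed_complete_tree)
  ultimately show ?thesis unfolding has_copy_def by blast
qed

subsection \<open>Treedepth\<close>

text \<open>A path through all of \<open>S\<close> has a complete closure, which contains every
  simple graph on \<open>S\<close>.\<close>

lemma rooted_tree_path:
  assumes "finite S" "S \<noteq> {}"
  obtains T r where "rooted_tree T r" "pverts T = S"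
    "\<And>x y. x \<in> S \<Longrightarrow> y \<in> S \<Longrightarrow> x \<noteq> y \<Longrightarrow> (x, y) \<in> parcs (tree_closure T)"
proof -
  define n where "n = card S"
  have n: "0 < n" using assms by (simp add: n_def card_gt_0_iff)
  obtain g where g: "bij_betw g {0..<n} S" using ex_bij_betw_nat_finite[OF assms(1)] by (auto simp: n_def)
  have g_inj: "g i = g j \<longleftrightarrow> i = j" if "i < n" "j < n" for i j
    using g that by (auto simp: bij_betw_def inj_on_def)
  have gS: "g i \<in> S" if "i < n" for i using g that by (auto simp: bij_betw_def)
  have S: "\<exists>i < n. x = g i" if "x \<in> S" for x using g that by (force simp: bij_betw_def)
  define T where "T = \<lparr>pverts = S, parcs = (\<lambda>i. (g i, g (Suc i))) ` {i. Suc i < n}\<rparr>"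
  have "finite {i. Suc i < n}" by (rule finite_subset[of _ "{..<n}"]) auto
  then interpret pair_fin_digraph T
    using assms(1) gS by unfold_locales (auto simp: T_def)
  have arcs: "(g i, g (Suc i)) \<in> parcs T" if "Suc i < n" for i using that by (simp add: T_def)
  have walk: "awalk (g i) (map (\<lambda>m. (g m, g (Suc m))) [i..<j]) (g j)" if "i \<le> j" "j < n" for i j
    using that
  proof (induction j rule: dec_induct)
    case base
    then have "g i \<in> pverts T" using gS by (simp add: T_def)
    then show ?case by (simp add: awalk_Nil_iff)
  next
    case (step j)
    have "awalk (g j) [(g j, g (Suc j))] (g (Suc j))"
      using arc_implies_awalk[OF arcs[of j]] step by simp
    then show ?case using step by (auto intro!: awalk_appendI)
  qed
  \<comment> \<open>Each vertex of the path has at most one outgoing arc, so the arcs of a walk are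
    forced one after another.\<close>
  have walk_unique: "p = map (\<lambda>m. (g m, g (Suc m))) [i..<j] \<and> i \<le> j"
    if "awalk (g i) p (g j)" "i < n" "j < n" for p i j
    using that
  proof (induction p arbitrary: i)
    case Nil
    then show ?case using g_inj by (simp add: awalk_Nil_iff)
  next
    case (Cons e p)
    then have e: "e \<in> parcs T" "g i = fst e" "awalk (snd e) p (g j)" by (auto simp: awalk_Cons_iff)
    then obtain m where m: "e = (g m, g (Suc m))" "Suc m < n" by (auto simp: T_def)
    then have "m = i" using e(2) g_inj[of i m] Cons.prems by simp
    then have "awalk (g (Suc i)) p (g j)" "Suc i < n" using e(3) m by simp_all
    then have "p = map (\<lambda>m. (g m, g (Suc m))) [Suc i..<j] \<and> Suc i \<le> j"
      using Cons.IH[of "Suc i"] Cons.prems(3) by blast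
    moreover from this have "[i..<j] = i # [Suc i..<j]" by (intro upt_conv_Cons) simp
    moreover have "e = (g i, g (Suc i))" using m(1) \<open>m = i\<close> by blast
    ultimately show ?case by (simp only: list.map) simp
  qed
  have "rooted_tree T (g 0)"
    unfolding rooted_tree_def
  proof (intro conjI ballI)
    fix v assume "v \<in> pverts T"
    then obtain j where "j < n" "v = g j" using S by (auto simp: T_def)
    then show "\<exists>!p. awalk (g 0) p v" using walk[of 0 j] walk_unique[of 0 _ j] n by blast
  qed (use gS[OF n] pair_fin_digraph in \<open>auto simp: T_def\<close>)
  moreover have "(x, y) \<in> parcs (tree_closure T)" if xy: "x \<in> S" "y \<in> S" "x \<noteq> y" for x y
  proof -
    have less: "(g i, g j) \<in> (parcs T)\<^sup>+" if "i < j" "j < n" for i j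
      using walk[of i j] that by (intro reachable1_awalkI) auto
    obtain i j where "i < n" "x = g i" "j < n" "y = g j" "i \<noteq> j"
      using S[OF xy(1)] S[OF xy(2)] xy(3) by blast
    then show ?thesis using less[of i j] less[of j i] by (auto simp: tree_closure_def nat_neq_iff)
  qed
  ultimately show ?thesis using that[of T "g 0"] by (simp add: T_def)
qed

text \<open>The \<open>LEAST\<close> in \<open>connected_treedepth\<close> is attained because some
  tree qualifies: a path through all vertices.\<close>

lemma connected_treedepth_attained:
  assumes "finite (verts H)" "verts H \<noteq> {}" "wf_digraph H" "tail H = fst" "head H = snd"
    "\<And>e. e \<in> arcs H \<Longrightarrow> fst e \<noteq> snd e"
  obtains T r where "rooted_tree T r" "subgraph H (with_proj (tree_closure T))"
    "rooted_depth T r = connected_treedepth H"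
proof -
  interpret H: wf_digraph H by fact
  obtain T r where T: "rooted_tree T r" "pverts T = verts H"
    "\<And>x y. x \<in> verts H \<Longrightarrow> y \<in> verts H \<Longrightarrow> x \<noteq> y \<Longrightarrow> (x, y) \<in> parcs (tree_closure T)"
    using rooted_tree_path[OF assms(1,2)] by blast
  interpret T: pair_fin_digraph T using T(1) by (simp add: rooted_tree_def)
  have "wf_digraph (with_proj (tree_closure T))"
    by unfold_locales (auto simp: tree_closure_def dest: T.reachable1_in_verts)
  moreover have "arcs H \<subseteq> parcs (tree_closure T)"
  proof
    fix e assume e: "e \<in> arcs H"
    then have "fst e \<in> verts H" "snd e \<in> verts H" "fst e \<noteq> snd e"
      using H.tail_in_verts[OF e] H.head_in_verts[OF e] assms(4-6) by auto
    then show "e \<in> parcs (tree_closure T)" using T(3)[of "fst e" "snd e"] by simp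
  qed
  ultimately have "subgraph H (with_proj (tree_closure T))"
    using assms(3-5) T(2) by (intro subgraphI) (auto simp: compatible_def tree_closure_def)
  then have "\<exists>d. \<exists>T r. rooted_tree T r \<and> subgraph H (with_proj (tree_closure T)) \<and> rooted_depth T r = d"
    using T(1) by blast
  then have "\<exists>T r. rooted_tree T r \<and> subgraph H (with_proj (tree_closure T)) \<and>
      rooted_depth T r = connected_treedepth H"
    unfolding connected_treedepth_def by (rule LeastI_ex)
  then show ?thesis using that by blast
qed

context
  fixes T :: "'a pair_pre_digraph" and r :: 'a
  assumes rooted: "rooted_tree T r"
begin

interpretation T: pair_fin_digraph T
  using rooted by (simp add: rooted_tree_def)

lemma root_walk_ex1: "v \<in> pverts T \<Longrightarrow> \<exists>!p. T.awalk r p v"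
  using rooted by (simp add: rooted_tree_def)

text \<open>A root walk to \<open>x\<close> followed by a walk from \<open>x\<close> to
  \<open>y\<close> is a root walk to \<open>y\<close>, and there is only one.\<close>

lemma root_walk_append:
  assumes "T.awalk r p y" "x \<rightarrow>\<^sup>*\<^bsub>with_proj T\<^esub> y"
  obtains p1 p2 where "p = p1 @ p2" "T.awalk r p1 x" "T.awalk x p2 y"
proof -
  obtain q where q: "T.awalk x q y" using assms(2) T.reachable_awalk by blast
  have "x \<in> pverts T" using q T.awalk_hd_in_verts by blast
  then obtain p1 where p1: "T.awalk r p1 x" using root_walk_ex1 by blast
  from this q have "T.awalk r (p1 @ q) y" by (rule T.awalk_appendI)
  moreover have "y \<in> pverts T" using q T.awalk_last_in_verts by blast
  ultimately have "p = p1 @ q" using root_walk_ex1 assms(1) by blast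
  then show ?thesis using that p1 q by blast
qed

text \<open>The root walks to \<open>x\<close> and \<open>y\<close> are prefixes of the root walk to
  \<open>z\<close>, so one is a prefix of the other.\<close>

lemma rooted_tree_laminar:
  assumes "x \<rightarrow>\<^sup>*\<^bsub>with_proj T\<^esub> z" "y \<rightarrow>\<^sup>*\<^bsub>with_proj T\<^esub> z"
  shows "x \<rightarrow>\<^sup>*\<^bsub>with_proj T\<^esub> y \<or> y \<rightarrow>\<^sup>*\<^bsub>with_proj T\<^esub> x"
proof -
  have "z \<in> pverts T" using assms(1) T.reachable_in_verts by blast
  then obtain p where p: "T.awalk r p z" using root_walk_ex1 by blast
  obtain p1 p2 where 1: "p = p1 @ p2" "T.awalk r p1 x" "T.awalk x p2 z"
    using root_walk_append[OF p assms(1)] by blast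
  obtain q1 q2 where 2: "p = q1 @ q2" "T.awalk r q1 y" "T.awalk y q2 z"
    using root_walk_append[OF p assms(2)] by blast
  have *: "b \<rightarrow>\<^sup>*\<^bsub>with_proj T\<^esub> a" if "T.awalk r (u @ w) a" "T.awalk r u b" for u w a b
  proof -
    have "T.awalk (T.awlast r u) w a" using that(1) by simp
    moreover have "T.awlast r u = b" using that(2) T.awlast_if_cas by (simp add: T.awalk_def)
    ultimately show ?thesis using T.reachable_awalk by blast
  qed
  obtain us where "p1 = q1 @ us \<or> q1 = p1 @ us"
    using 1(1) 2(1) by (auto simp: append_eq_append_conv2)
  then show ?thesis using * 1(2) 2(2) by blast
qed

text \<open>A closed walk from \<open>x\<close> through \<open>y\<close> would lengthen the unique
  root walk to \<open>x\<close>.\<close>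

lemma rooted_tree_antisym:
  assumes "x \<rightarrow>\<^sup>*\<^bsub>with_proj T\<^esub> y" "y \<rightarrow>\<^sup>*\<^bsub>with_proj T\<^esub> x"
  shows "x = y"
proof -
  have "x \<in> pverts T" using assms(1) T.reachable_in_verts by blast
  then obtain p where p: "T.awalk r p x" using root_walk_ex1 by blast
  obtain p1 p2 where 1: "p = p1 @ p2" "T.awalk r p1 y" "T.awalk y p2 x"
    using root_walk_append[OF p assms(2)] by blast
  obtain q1 q2 where 2: "p1 = q1 @ q2" "T.awalk r q1 x" "T.awalk x q2 y"
    using root_walk_append[OF 1(2) assms(1)] by blast
  have "q1 = p" using root_walk_ex1[OF \<open>x \<in> pverts T\<close>] p 2(2) by blast
  then have "p2 = []" using 1(1) 2(1) by simp
  then show ?thesis using 1(3) by (simp add: T.awalk_Nil_iff)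
qed

text \<open>\<open>rooted_depth\<close> ranges over walks to leaves, but a longest root walk must
  end at a leaf. It exists since there is only one root walk per vertex. The inequality is strict
  because depth counts vertices and \<open>length p\<close> counts arcs.\<close>

lemma length_root_walk:
  assumes "T.awalk r p v"
  shows "length p < rooted_depth T r"
proof -
  define W where "W = {(p, v). T.awalk r p v}"
  have "inj_on snd W" using root_walk_ex1 T.awalk_last_in_verts by (force simp: W_def inj_on_def)
  moreover have "snd ` W \<subseteq> pverts T" using T.awalk_last_in_verts by (auto simp: W_def)
  then have "finite (snd ` W)" using T.pair_finite_verts by (rule finite_subset)
  ultimately have "finite W" by (rule finite_imageD[rotated])
  have pW: "(p, v) \<in> W" using assms by (simp add: W_def)
  define b where "b = Suc (Max ((length \<circ> fst) ` W))"
  have "\<forall>w. w \<in> W \<longrightarrow> length (fst w) < b"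
    using \<open>finite W\<close> by (auto simp: b_def intro!: le_imp_less_Suc Max_ge rev_image_eqI)
  then obtain w where w: "w \<in> W" "\<And>w'. w' \<in> W \<Longrightarrow> length (fst w') \<le> length (fst w)"
    using pW ex_has_greatest_nat[of "\<lambda>w. w \<in> W" "(p, v)" "\<lambda>w. length (fst w)" b] by blast
  obtain q u where qu: "w = (q, u)" by (cases w)
  then have q: "T.awalk r q u" using w(1) by (simp add: W_def)
  have "out_arcs T u = {}"
  proof (rule ccontr)
    assume "out_arcs T u \<noteq> {}"
    then obtain x where "(u, x) \<in> parcs T" by auto
    then have "T.awalk u [(u, x)] x" using T.arc_implies_awalk[of "(u, x)"] by simp
    then have "(q @ [(u, x)], x) \<in> W" using T.awalk_appendI[OF q] by (simp add: W_def)
    then show False using w(2)[of "(q @ [(u, x)], x)"] qu by simp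
  qed
  then have "out_degree (with_proj T) u = 0" by (simp add: out_degree_def)
  let ?M = "{length (pawalk_verts r p) | p v. T.awalk r p v \<and> out_degree (with_proj T) v = 0}"
  have "?M \<subseteq> (\<lambda>(p, v). length (pawalk_verts r p)) ` W" by (force simp: W_def)
  then have "finite ?M" by (rule finite_subset[OF _ finite_imageI[OF \<open>finite W\<close>]])
  moreover have "length (pawalk_verts r q) \<in> ?M" using q \<open>out_degree _ u = 0\<close> by blast
  ultimately have "length (pawalk_verts r q) \<le> rooted_depth T r"
    unfolding rooted_depth_def by (rule Max_ge)
  moreover have "length (pawalk_verts r q) = Suc (length q)" using T.length_awalk_verts by simp
  ultimately show ?thesis using w(2)[OF pW] qu by simp
qed

lemma card_tree_ancestors:
  assumes "y \<in> pverts T"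
  shows "finite {x. x \<rightarrow>\<^sup>*\<^bsub>with_proj T\<^esub> y}" "card {x. x \<rightarrow>\<^sup>*\<^bsub>with_proj T\<^esub> y} \<le> rooted_depth T r"
proof -
  obtain p where p: "T.awalk r p y" using root_walk_ex1[OF assms] by blast
  have sub: "{x. x \<rightarrow>\<^sup>*\<^bsub>with_proj T\<^esub> y} \<subseteq> set (T.awalk_verts r p)"
  proof
    fix x assume "x \<in> {x. x \<rightarrow>\<^sup>*\<^bsub>with_proj T\<^esub> y}"
    then obtain p1 p2 where 1: "p = p1 @ p2" "T.awalk r p1 x" "T.awalk x p2 y"
      using root_walk_append[OF p] by blast
    then have "T.awlast r p1 = x" using T.awlast_if_cas by (simp add: T.awalk_def)
    then have "x \<in> set (T.awalk_verts r p1)" using last_in_set[of "pawalk_verts r p1"] by (cases p1) auto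
    then show "x \<in> set (T.awalk_verts r p)"
      using 1(1) p by (auto simp: T.awalk_verts_append)
  qed
  show "finite {x. x \<rightarrow>\<^sup>*\<^bsub>with_proj T\<^esub> y}" using sub by (rule finite_subset) simp
  have "card {x. x \<rightarrow>\<^sup>*\<^bsub>with_proj T\<^esub> y} \<le> card (set (T.awalk_verts r p))"
    using sub by (rule card_mono[rotated]) simp
  also have "\<dots> \<le> length (T.awalk_verts r p)" by (rule card_length)
  also have "\<dots> = Suc (length p)" using T.length_awalk_verts by simp
  also have "\<dots> \<le> rooted_depth T r" using length_root_walk[OF p] by simp
  finally show "card {x. x \<rightarrow>\<^sup>*\<^bsub>with_proj T\<^esub> y} \<le> rooted_depth T r" .
qed

end

text \<open>Combines one optimal tree per component. Nothing forces the subtrees to induce connected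
  graphs, so only a preforest results.\<close>

lemma treedepth_elimination_preforest:
  assumes "pair_graph G" "treedepth G \<le> b"
  obtains D where "elimination_preforest (pverts G) (parcs G) D"
    "\<And>x. card (elimination_preforest.Anc D x) \<le> b"
proof -
  interpret pair_graph G by fact
  have "\<exists>T. \<exists>r. rooted_tree T r \<and> subgraph C (with_proj (tree_closure T)) \<and> rooted_depth T r \<le> b"
    if C: "C \<in> components G" for C
  proof -
    have "connected_treedepth C \<le> treedepth G"
      unfolding treedepth_def using finite_components C by (intro Max_ge) auto
    then have "connected_treedepth C \<le> b" using assms(2) by simp
    have ind: "induced_subgraph C G" and sc: "strongly_connected C"
      using C by (auto simp: sccs_def)
    have sub: "subgraph C G" using ind by (rule induced_imp_subgraph)
    have "verts C \<noteq> {}" using sc by (simp add: strongly_connected_def)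
    moreover have "finite (verts C)"
      using subgraph_imp_subverts[OF sub] pair_finite_verts by (simp add: finite_subset)
    moreover have "wf_digraph C" "tail C = fst" "head C = snd" "arcs C \<subseteq> parcs G"
      using sub by (auto simp: subgraph_def compatible_def)
    ultimately obtain T r where "rooted_tree T r" "subgraph C (with_proj (tree_closure T))"
        "rooted_depth T r = connected_treedepth C"
      using connected_treedepth_attained[of C] pair_no_loops by blast
    moreover from this have "rooted_depth T r \<le> b" using \<open>connected_treedepth C \<le> b\<close> by simp
    ultimately show ?thesis by blast
  qed
  then obtain T where "\<forall>C \<in> components G. \<exists>r. rooted_tree (T C) r \<and>
      subgraph C (with_proj (tree_closure (T C))) \<and> rooted_depth (T C) r \<le> b"
    by metis
  then obtain r where T: "\<And>C. C \<in> components G \<Longrightarrow> rooted_tree (T C) (r C)"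
      "\<And>C. C \<in> components G \<Longrightarrow> subgraph C (with_proj (tree_closure (T C)))"
      "\<And>C. C \<in> components G \<Longrightarrow> rooted_depth (T C) (r C) \<le> b"
    by metis
  have T_verts: "verts C \<subseteq> pverts (T C)" if "C \<in> components G" for C
    using subgraph_imp_subverts[OF T(2)[OF that]] by (simp add: tree_closure_def)
  have T_wf: "wf_digraph (with_proj (T C))" if "C \<in> components G" for C
    using T(1)[OF that] by (simp add: rooted_tree_def pair_fin_digraph_def wf_digraph_wp_iff)
  have C_eq: "C = C'" if "C \<in> components G" "C' \<in> components G" "x \<in> verts C" "x \<in> verts C'" for C C' x
    using scc_disj that by blast
  have comp: "\<exists>C \<in> components G. x \<in> verts C \<and> (\<forall>y. (x, y) \<in> parcs G \<longrightarrow> y \<in> verts C \<and> (x, y) \<in> arcs C)"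
    if x: "x \<in> pverts G" for x
  proof (rule bexI)
    let ?C = "with_proj G \<restriction> {v. x \<rightarrow>\<^sup>*\<^bsub>with_proj G\<^esub> v}"
    show "?C \<in> components G" using induce_reachable_is_in_sccs x by simp
    show "x \<in> verts ?C \<and> (\<forall>y. (x, y) \<in> parcs G \<longrightarrow> y \<in> verts ?C \<and> (x, y) \<in> arcs ?C)"
      using x by (auto intro: reachable_adjI)
  qed
  \<comment> \<open>The trees may overlap and may have vertices outside their components, so each
    ancestor relation is restricted to its own component.\<close>
  define D where "D x = {y. \<exists>C \<in> components G. x \<in> verts C \<and> y \<in> verts C \<and>
      x \<rightarrow>\<^sup>*\<^bsub>with_proj (T C)\<^esub> y}" for x
  have D_D: "x \<in> verts C \<and> x \<rightarrow>\<^sup>*\<^bsub>with_proj (T C)\<^esub> y"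
    if y: "y \<in> D x" and C: "C \<in> components G" "y \<in> verts C" for x y C
  proof -
    obtain C' where C': "C' \<in> components G" "x \<in> verts C'" "y \<in> verts C'" "x \<rightarrow>\<^sup>*\<^bsub>with_proj (T C')\<^esub> y"
      using y by (auto simp: D_def)
    have "C' = C" using C_eq[OF C'(1) C(1) C'(3) C(2)] .
    then show ?thesis using C' by blast
  qed
  have verts_sub: "verts C \<subseteq> pverts G" if "C \<in> components G" for C
    using subgraph_imp_subverts[OF induced_imp_subgraph[OF in_sccs_imp_induced[OF that]]] by simp
  have D: "elimination_preforest (pverts G) (parcs G) D"
  proof
    show "finite (pverts G)" by simp
    show "sym (parcs G)" using arcs_symmetric by (auto intro: symI)
    fix x y z
    show "x \<in> pverts G \<and> y \<in> pverts G" if "y \<in> D x" using that verts_sub by (auto simp: D_def)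
    show "x \<in> D x" if x: "x \<in> pverts G"
    proof -
      obtain C where "C \<in> components G" "x \<in> verts C" using comp[OF x] by blast
      then show ?thesis using T_verts wf_digraph.reachable_refl[OF T_wf, of C x] by (auto simp: D_def)
    qed
    show "D y \<subseteq> D x" if "y \<in> D x"
    proof
      fix z assume "z \<in> D y"
      then obtain C where C: "C \<in> components G" "y \<in> verts C" "z \<in> verts C" "y \<rightarrow>\<^sup>*\<^bsub>with_proj (T C)\<^esub> z"
        by (auto simp: D_def)
      then have "x \<in> verts C" "x \<rightarrow>\<^sup>*\<^bsub>with_proj (T C)\<^esub> y" using D_D[OF that] by blast+
      then show "z \<in> D x"
        using C wf_digraph.reachable_trans[OF T_wf[OF C(1)]] by (auto simp: D_def)
    qed
    show "x \<in> D y \<or> y \<in> D x" if z: "z \<in> D x" "z \<in> D y"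
    proof -
      obtain C where C: "C \<in> components G" "x \<in> verts C" "z \<in> verts C" "x \<rightarrow>\<^sup>*\<^bsub>with_proj (T C)\<^esub> z"
        using z(1) by (auto simp: D_def)
      then have y: "y \<in> verts C" "y \<rightarrow>\<^sup>*\<^bsub>with_proj (T C)\<^esub> z" using D_D[OF z(2)] by blast+
      then show ?thesis using rooted_tree_laminar[OF T(1)[OF C(1)] C(4) y(2)] C by (auto simp: D_def)
    qed
    show "x = y" if xy: "x \<in> D y" "y \<in> D x"
    proof -
      obtain C where C: "C \<in> components G" "x \<in> verts C" "y \<in> verts C" "y \<rightarrow>\<^sup>*\<^bsub>with_proj (T C)\<^esub> x"
        using xy(1) by (auto simp: D_def)
      then have "x \<rightarrow>\<^sup>*\<^bsub>with_proj (T C)\<^esub> y" using D_D[OF xy(2)] by blast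
      then show ?thesis using rooted_tree_antisym[OF T(1)[OF C(1)]] C(4) by blast
    qed
    show "x \<in> D y \<or> y \<in> D x" if xy: "(x, y) \<in> parcs G"
    proof -
      obtain C where C: "C \<in> components G" "x \<in> verts C" "y \<in> verts C" "(x, y) \<in> arcs C"
        using comp[OF in_arcsD1[OF xy]] xy by blast
      then have "(x, y) \<in> parcs (tree_closure (T C))" using T(2) by (auto simp: subgraph_def)
      then have "x \<rightarrow>\<^sup>*\<^bsub>with_proj (T C)\<^esub> y \<or> y \<rightarrow>\<^sup>*\<^bsub>with_proj (T C)\<^esub> x"
        using wf_digraph.reachable1_reachable[OF T_wf[OF C(1)]] by (auto simp: tree_closure_def)
      then show ?thesis using C by (auto simp: D_def)
    qed
  qed
  interpret D: elimination_preforest "pverts G" "parcs G" D by (rule D)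
  have "card (D.Anc x) \<le> b" for x
  proof (cases "x \<in> pverts G")
    case True
    then obtain C where C: "C \<in> components G" "x \<in> verts C" using comp by blast
    then have x: "x \<in> pverts (T C)" using T_verts by blast
    have "D.Anc x \<subseteq> {y. y \<rightarrow>\<^sup>*\<^bsub>with_proj (T C)\<^esub> x}"
      using C(1,2) D_D by (auto simp: D.Anc_def)
    then have "card (D.Anc x) \<le> card {y. y \<rightarrow>\<^sup>*\<^bsub>with_proj (T C)\<^esub> x}"
      using card_tree_ancestors(1)[OF T(1)[OF C(1)] x] by (intro card_mono)
    then show ?thesis
      using card_tree_ancestors(2)[OF T(1)[OF C(1)] x] T(3)[OF C(1)] by linarith
  next
    case False
    then have "D.Anc x = {}" using D.D_dom by (auto simp: D.Anc_def)
    then show ?thesis by simp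
  qed
  then show ?thesis using that D by blast
qed

section \<open>The upper bound and the equality of the three parameters\<close>

lemma clustered_colourable_if_no_copy:
  assumes "pair_graph G" "G \<in> \<G>" "minor_closed \<G>" "treedepth G \<le> b"
    "h \<ge> 1" "\<not> has_copy \<G> C\<langle>h,k\<rangle>"
  shows "clustered_colourable (h - 1) (Suc (2 ^ Suc b * h * k) ^ Suc b) G"
proof -
  interpret pair_graph G by fact
  obtain D where D: "elimination_preforest (pverts G) (parcs G) D"
      "\<And>x. card (elimination_preforest.Anc D x) \<le> b"
    using treedepth_elimination_preforest[OF assms(1,4)] by blast
  interpret D: elimination_preforest "pverts G" "parcs G" D by (rule D)
  interpret F: elimination_forest "pverts G" "parcs G" "\<lambda>x. {y. (x, y) \<in> rtrancl_on (D x) (parcs G)}"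
    by (rule D.elimination_forest_components)
  have Anc: "card (F.Anc x) \<le> b" for x
    using card_mono[OF D.finite_Anc D.Anc_components_subset] D(2) le_trans by blast
  have no_model: "\<not> rich (parcs G) k h {} {y. (v, y) \<in> rtrancl_on (D v) (parcs G)}" for v
    using has_copy_if_rich[OF assms(1-3)] assms(6) F.D_dom by blast
  show ?thesis
    by (rule F.clustered_labelling[OF assms(5) Anc no_model])
      (rule clustered_colourableI[OF pair_finite_verts])
qed

theorem theorem1:
  fixes \<G> :: "nat pair_pre_digraph set"
  assumes "\<And>G. G \<in> \<G> \<Longrightarrow> pair_graph G"
    and "minor_closed \<G>"
    and "bounded_treedepth \<G>"
  shows "defective_chromatic \<G> = clustered_chromatic \<G> \<and> clustered_chromatic \<G> = tcn \<G> - 1"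
proof -
  have "tcn \<G> - 1 \<le> defective_chromatic \<G>"
    unfolding defective_chromatic_def
  proof (rule Inf_greatest, clarify)
    fix c d assume col: "\<forall>G \<in> \<G>. defective_colourable c d G"
    \<comment> \<open>Branching \<open>Suc d\<close> exceeds the defect and height
      \<open>Suc c\<close> the number of colours.\<close>
    have "\<not> has_copy \<G> C\<langle>Suc c,Suc d\<rangle>"
    proof
      assume "has_copy \<G> C\<langle>Suc c,Suc d\<rangle>"
      then obtain G where G: "G \<in> \<G>" "digraph_iso (with_proj C\<langle>Suc c,Suc d\<rangle>) (with_proj G)"
        by (auto simp: has_copy_def)
      then have "Suc c \<le> c"
        using defective_colours_closed_complete_tree[OF assms(1)] col by blast
      then show False by simp
    qed
    then have "tcn \<G> \<le> enat (Suc c)"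
      unfolding tcn_def by (intro Inf_lower CollectI exI[of _ "Suc c"] conjI exI[of _ "Suc d"]) auto
    then show "tcn \<G> - 1 \<le> enat c" by (cases "tcn \<G>") (auto simp: one_enat_def)
  qed
  moreover have "defective_chromatic \<G> \<le> clustered_chromatic \<G>"
    unfolding defective_chromatic_def clustered_chromatic_def
  proof (rule Inf_superset_mono, clarify)
    fix k c assume col: "\<forall>G \<in> \<G>. clustered_colourable k c G"
    have "defective_colourable k c G" if "G \<in> \<G>" for G
    proof -
      interpret pair_graph G using assms(1) that .
      show ?thesis using col that by (intro clustered_imp_defective) auto
    qed
    then show "\<exists>j. enat k = enat j \<and> (\<exists>d. \<forall>G \<in> \<G>. defective_colourable j d G)" by blast
  qed
  moreover have "clustered_chromatic \<G> \<le> tcn \<G> - 1"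
  proof (cases "tcn \<G>")
    case (enat h)
    let ?A = "{enat h | h. h \<ge> 1 \<and> (\<exists>k \<ge> 1. \<not> has_copy \<G> C\<langle>h,k\<rangle>)}"
    \<comment> \<open>A finite \<open>tcn\<close> is an attained minimum, which supplies
      \<open>h\<close> and \<open>k\<close>. In the other case
      \<open>\<infinity> - 1 = \<infinity>\<close> makes the bound trivial.\<close>
    have "?A \<noteq> {}" using enat unfolding tcn_def by (metis Inf_empty enat.distinct(1) top_enat_def)
    then have "tcn \<G> = (LEAST x. x \<in> ?A)" unfolding tcn_def Inf_enat_def by (rule if_not_P)
    moreover have "(LEAST x. x \<in> ?A) \<in> ?A"
      using \<open>?A \<noteq> {}\<close> LeastI_ex[of "\<lambda>x. x \<in> ?A"] by blast
    ultimately have "tcn \<G> \<in> ?A" by (rule ssubst)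
    then obtain k where h: "h \<ge> 1" "\<not> has_copy \<G> C\<langle>h,k\<rangle>" using enat by auto
    obtain b where "\<forall>G \<in> \<G>. treedepth G \<le> b" using assms(3) by (auto simp: bounded_treedepth_def)
    then have "\<forall>G \<in> \<G>. clustered_colourable (h - 1) (Suc (2 ^ Suc b * h * k) ^ Suc b) G"
      using clustered_colourable_if_no_copy assms(1,2) h by blast
    then have "clustered_chromatic \<G> \<le> enat (h - 1)"
      unfolding clustered_chromatic_def by (intro Inf_lower) blast
    then show ?thesis using enat by (simp add: one_enat_def)
  qed simp
  ultimately show ?thesis by (auto intro: antisym order.trans)
qed

end
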